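(* For any planar graph $G$ with maximum degree $\Delta(G)\ge 12$ and any integer $k\ge 1$, we have $\mathit{ch}_k(G)\le\bigl\lfloor\frac{2\,\Delta(G)+19}{k}\bigr\rfloor+6$.
   Context: All graphs are finite and simple. For an integer $k\ge1$, a $k$-frugal colouring of a graph $G$ is a proper vertex colouring (adjacent vertices get different colours) such that no colour appears more than $k$ times in the neighbourhood of any vertex. A $t$-list assignment $L$ assigns to each vertex $v$ a list $L(v)$ of $t$ integers. The $k$-frugal choice number $\mathit{ch}_k(G)$ is the minimum $t$ such that for every $t$-list assignment $L$ there is a $k$-frugal colouring of $G$ in which every vertex $v$ receives a colour from $L(v)$. *)

theory Defs
  imports "HOL-Analysis.Analysis"
begin

definition simple_graph :: "'a set \<Rightarrow> 'a set set \<Rightarrow> bool" where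
  "simple_graph V E \<longleftrightarrow> finite V \<and> (\<forall>e\<in>E. e \<subseteq> V \<and> card e = 2)"

definition neighbourhood :: "'a set set \<Rightarrow> 'a \<Rightarrow> 'a set" where
  "neighbourhood E v = {u. {v, u} \<in> E}"

definition vertex_degree :: "'a set set \<Rightarrow> 'a \<Rightarrow> nat" where
  "vertex_degree E v = card (neighbourhood E v)"

(* The inserted 0 only matters for the graph without vertices, where Max {} would be unspecified. *)
definition max_degree :: "'a set \<Rightarrow> 'a set set \<Rightarrow> nat" where
  "max_degree V E = Max (insert 0 (vertex_degree E ` V))"

(* The plane is the type complex.  Vertices are drawn as distinct points and edges as arbitrary
   simple arcs joining their endpoints; an arc meets the drawn vertices only in its own endpoints,
   and two different arcs meet only in the common endpoints of the two edges. *)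
definition plane_drawing ::
    "'a set \<Rightarrow> 'a set set \<Rightarrow> ('a \<Rightarrow> complex) \<Rightarrow> ('a set \<Rightarrow> real \<Rightarrow> complex) \<Rightarrow> bool" where
  "plane_drawing V E p \<gamma> \<longleftrightarrow>
     inj_on p V \<and>
     (\<forall>e\<in>E. arc (\<gamma> e) \<and> {pathstart (\<gamma> e), pathfinish (\<gamma> e)} = p ` e \<and>
             path_image (\<gamma> e) \<inter> p ` V = p ` e) \<and>
     (\<forall>e\<in>E. \<forall>f\<in>E. e \<noteq> f \<longrightarrow> path_image (\<gamma> e) \<inter> path_image (\<gamma> f) = p ` (e \<inter> f))"

definition planar :: "'a set \<Rightarrow> 'a set set \<Rightarrow> bool" where
  "planar V E \<longleftrightarrow> (\<exists>p \<gamma>. plane_drawing V E p \<gamma>)"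

definition proper_colouring :: "'a set set \<Rightarrow> ('a \<Rightarrow> 'c) \<Rightarrow> bool" where
  "proper_colouring E c \<longleftrightarrow> (\<forall>u v. {u, v} \<in> E \<longrightarrow> c u \<noteq> c v)"

definition frugal_colouring :: "nat \<Rightarrow> 'a set \<Rightarrow> 'a set set \<Rightarrow> ('a \<Rightarrow> 'c) \<Rightarrow> bool" where
  "frugal_colouring k V E c \<longleftrightarrow>
     proper_colouring E c \<and> (\<forall>v\<in>V. \<forall>x. card {u \<in> neighbourhood E v. c u = x} \<le> k)"

(* A list is, as usual in list colouring, a set of colours. *)
definition list_assignment :: "nat \<Rightarrow> 'a set \<Rightarrow> ('a \<Rightarrow> int set) \<Rightarrow> bool" where
  "list_assignment t V L \<longleftrightarrow> (\<forall>v\<in>V. finite (L v) \<and> card (L v) = t)"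

definition frugal_choosable :: "nat \<Rightarrow> nat \<Rightarrow> 'a set \<Rightarrow> 'a set set \<Rightarrow> bool" where
  "frugal_choosable k t V E \<longleftrightarrow>
     (\<forall>L. list_assignment t V L \<longrightarrow> (\<exists>c. frugal_colouring k V E c \<and> (\<forall>v\<in>V. c v \<in> L v)))"

definition frugal_choice_number :: "nat \<Rightarrow> 'a set \<Rightarrow> 'a set set \<Rightarrow> nat" where
  "frugal_choice_number k V E = (LEAST t. frugal_choosable k t V E)"

(* The minimum above is attained: lists of size card V admit an injective choice of colours. *)
lemma frugal_choosable_card:
  assumes G: "simple_graph V E" and k: "k \<ge> 1"
  shows "frugal_choosable k (card V) V E"
  unfolding frugal_choosable_def
proof (intro allI impI)
  fix L :: "'a \<Rightarrow> int set"
  assume L: "list_assignment (card V) V L"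
  have V: "finite V"
    using G by (simp add: simple_graph_def)
  have "\<exists>c. inj_on c W \<and> (\<forall>v\<in>W. c v \<in> L v)" if "W \<subseteq> V" for W
    using finite_subset[OF that V] that
  proof (induction W rule: finite_induct)
    case empty
    show ?case by simp
  next
    case (insert w W)
    then obtain c where c: "inj_on c W" "\<forall>v\<in>W. c v \<in> L v" by auto
    have "card (c ` W) < card (L w)"
    proof -
      have "card (c ` W) \<le> card W" by (rule card_image_le) fact
      also have "card W < card V"
        using insert V by (intro psubset_card_mono) auto
      finally show ?thesis using L insert.prems by (simp add: list_assignment_def)
    qed
    then have "\<not> L w \<subseteq> c ` W"
      using card_mono[of "c ` W" "L w"] \<open>finite W\<close> by auto
    then obtain x where "x \<in> L w" "x \<notin> c ` W" by auto
    then have "inj_on (c(w := x)) (insert w W) \<and> (\<forall>v\<in>insert w W. (c(w := x)) v \<in> L v)"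
      using c insert.hyps by (auto simp: inj_on_def)
    then show ?case by blast
  qed
  then obtain c where c: "inj_on c V" "\<forall>v\<in>V. c v \<in> L v" by blast
  have edge: "u \<in> V \<and> v \<in> V \<and> u \<noteq> v" if "{u, v} \<in> E" for u v
    using G that by (fastforce simp: simple_graph_def card_2_iff doubleton_eq_iff)
  have "card {u \<in> neighbourhood E v. c u = x} \<le> 1" for v x
    using c(1) edge by (auto simp: card_le_Suc0_iff_eq neighbourhood_def inj_on_def
        intro!: card_le_Suc0_iff_eq[THEN iffD2] finite_subset[OF _ V])
  then have "frugal_colouring k V E c"
    using c(1) edge k by (fastforce simp: frugal_colouring_def proper_colouring_def inj_on_def
        intro: order_trans)
  then show "\<exists>c. frugal_colouring k V E c \<and> (\<forall>v\<in>V. c v \<in> L v)"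
    using c(2) by blast
qed

end

theory Submission
  imports Defs
begin

text \<open>
  A minimal counterexample has no vertex \<open>v\<close> of degree at most 5 that can be contracted into a neighbour
  without exceeding the degree bound \<open>C\<close> and for which the degrees \<open>d u\<close> of its neighbours satisfy
  \<open>\<Sum>(d u - 1) \<le> 2 C + 19\<close>: at most \<open>(2 C + 19) div k\<close> colours occur \<open>k\<close> times around a neighbour
  of \<open>v\<close>, at most 5 more occur on the neighbours, and so \<open>v\<close> can be coloured last.

  That such a \<open>v\<close> exists follows from two edge counts alone, namely fewer than \<open>3 n\<close> edges, and at
  most \<open>2 n\<close> edges in a bipartite subgraph. For \<open>t = 12, 8, 7\<close> the second one, applied to the vertices
  of degree at most 5 against those of degree at least \<open>t\<close>, bounds \<open>\<Sum>(d\<^sub>t v - 2)\<close>, where \<open>d\<^sub>t v\<close> is the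
  number of neighbours of \<open>v\<close> of degree at least \<open>t\<close>; adding the three inequalities with weights 4, 1, 1
  shows that \<open>\<Sum>(d v - 6)\<close> would be nonnegative.

  The edge counts are Euler's formula in the form of two inequalities: by the Jordan curve theorem an
  arc that closes a cycle creates a face, and by Borsuk's logarithm criterion for separation an arc
  borders at most two faces. They are proved for drawings whose vertices are non-separating continua
  instead of points, because these drawings can be contracted by mere union.
\<close>

subsection \<open>An arc borders at most two faces\<close>

text \<open>Borsuk's notion of an inessential map: a continuous logarithm on \<open>S\<close> exists
  exactly if the map is homotopic to a constant in the punctured plane. It stands in for winding
  numbers around sets that are not curves.\<close>

definition has_clog :: "complex set \<Rightarrow> (complex \<Rightarrow> complex) \<Rightarrow> bool" where
  "has_clog S f \<longleftrightarrow> (\<exists>g. continuous_on S g \<and> (\<forall>z\<in>S. f z = exp (g z)))"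

text \<open>As \<open>y\<close> is closer to \<open>x\<close> than any point of \<open>K\<close>,
  the quotient \<open>(z - y) / (z - x)\<close> differs from 1 by less than 1. So it stays in the
  right half-plane, where the principal branch \<open>Ln\<close> is continuous.\<close>

lemma has_clog_divide_near:
  assumes r: "ball x r \<subseteq> - K" and y: "y \<in> ball x r"
  shows "has_clog K (\<lambda>z. (z - x) / (z - y))"
proof -
  have *: "(z - y) / (z - x) \<notin> \<real>\<^sub>\<le>\<^sub>0 \<and> z \<noteq> x \<and> z \<noteq> y" if z: "z \<in> K" for z
  proof -
    have zx: "norm (z - x) \<ge> r" "norm (x - y) < r"
      using r y z by (auto simp: dist_norm[symmetric] dist_commute subset_eq not_less[symmetric])
    have "r > 0" using zx(2) norm_ge_zero[of "x - y"] by linarith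
    then have ne: "z \<noteq> x" "z \<noteq> y" using zx norm_minus_commute[of x y] by auto
    then have "z - x \<noteq> 0" by simp
    then have eq: "(z - y) / (z - x) = 1 + (x - y) / (z - x)"
      using add_divide_distrib[of "z - x" "x - y" "z - x"] by simp
    have "norm ((x - y) / (z - x)) < 1"
      using zx ne by (simp add: norm_divide divide_less_eq)
    then have "\<bar>Re ((x - y) / (z - x))\<bar> < 1"
      using abs_Re_le_cmod[of "(x - y) / (z - x)"] by linarith
    then have "Re ((z - y) / (z - x)) > 0"
      unfolding eq plus_complex.sel one_complex.sel by linarith
    then show ?thesis using ne by (simp add: complex_nonpos_Reals_iff)
  qed
  have "continuous_on K (\<lambda>z. - Ln ((z - y) / (z - x)))"
    using * by (intro continuous_intros) auto
  moreover have "(z - x) / (z - y) = exp (- Ln ((z - y) / (z - x)))" if "z \<in> K" for z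
    using *[OF that] exp_Ln[of "(z - y) / (z - x)"] unfolding exp_minus by simp
  ultimately show ?thesis
    unfolding has_clog_def by (intro exI[of _ "\<lambda>z. - Ln ((z - y) / (z - x))"] conjI ballI)
qed

text \<open>Having such a logarithm is an equivalence relation between the two points, and by the
  previous lemma its classes are open; the connected component then lies in one class.\<close>

lemma has_clog_divide_same_component:
  assumes "closed K" and ab: "connected_component (- K) a b"
  shows "has_clog K (\<lambda>z. (z - a) / (z - b))"
proof (rule connected_equivalence_relation[of "connected_component_set (- K) a" a b])
  show "connected (connected_component_set (- K) a)" by simp
  show "a \<in> connected_component_set (- K) a" "b \<in> connected_component_set (- K) a"
    using ab connected_component_in by fastforce+
  have sub: "x \<in> connected_component_set (- K) a \<Longrightarrow> x \<notin> K" for x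
    using connected_component_subset by fastforce
  show "has_clog K (\<lambda>z. (z - y) / (z - x))"
    if xy: "has_clog K (\<lambda>z. (z - x) / (z - y))" for x y
  proof -
    obtain g where g: "continuous_on K g" "\<forall>z\<in>K. (z - x) / (z - y) = exp (g z)"
      using xy by (auto simp: has_clog_def)
    have "(z - y) / (z - x) = exp (- g z)" if "z \<in> K" for z
      unfolding exp_minus g(2)[rule_format, OF that, symmetric] by simp
    then show ?thesis
      unfolding has_clog_def using g(1)
      by (intro exI[of _ "\<lambda>z. - g z"]) (auto intro: continuous_on_minus)
  qed
  show "has_clog K (\<lambda>z. (z - x) / (z - w))"
    if xy: "has_clog K (\<lambda>z. (z - x) / (z - y))" and yw: "has_clog K (\<lambda>z. (z - y) / (z - w))"
      and y: "y \<in> connected_component_set (- K) a" for x y w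
  proof -
    obtain g where g: "continuous_on K g" "\<forall>z\<in>K. (z - x) / (z - y) = exp (g z)"
      using xy by (auto simp: has_clog_def)
    obtain h where h: "continuous_on K h" "\<forall>z\<in>K. (z - y) / (z - w) = exp (h z)"
      using yw by (auto simp: has_clog_def)
    have "\<forall>z\<in>K. (z - x) / (z - w) = exp (g z + h z)"
    proof
      fix z assume "z \<in> K"
      then have "z - y \<noteq> 0" using sub[OF y] by auto
      then have "(z - x) / (z - w) = ((z - x) / (z - y)) * ((z - y) / (z - w))" by simp
      then show "(z - x) / (z - w) = exp (g z + h z)"
        by (simp only: exp_add g(2)[rule_format, OF \<open>z \<in> K\<close>] h(2)[rule_format, OF \<open>z \<in> K\<close>])
    qed
    then show ?thesis
      unfolding has_clog_def using continuous_on_add[OF g(1) h(1)]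
      by (intro exI[of _ "\<lambda>z. g z + h z"]) auto
  qed
  show "\<exists>T. openin (top_of_set (connected_component_set (- K) a)) T \<and> x \<in> T \<and>
            (\<forall>y\<in>T. has_clog K (\<lambda>z. (z - x) / (z - y)))"
    if x: "x \<in> connected_component_set (- K) a" for x
  proof -
    have "open (- K)" "x \<in> - K" using sub[OF x] assms(1) by auto
    then obtain r where r: "r > 0" "ball x r \<subseteq> - K"
      by (rule openE)
    then have "\<forall>y\<in>connected_component_set (- K) a \<inter> ball x r. has_clog K (\<lambda>z. (z - x) / (z - y))"
      by (intro ballI has_clog_divide_near[of x r]) auto
    moreover have "openin (top_of_set (connected_component_set (- K) a)) (connected_component_set (- K) a \<inter> ball x r)"
      by (simp add: openin_open_Int)
    moreover have "x \<in> connected_component_set (- K) a \<inter> ball x r"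
      using x r(1) by simp
    ultimately show ?thesis
      by (intro exI[of _ "connected_component_set (- K) a \<inter> ball x r"] conjI)
  qed
qed

text \<open>The power winds \<open>n\<close> times around 0 along the circle, and a logarithm allows
  no winding.\<close>

lemma has_clog_powi_circle:
  assumes "has_clog (sphere a r) (\<lambda>z. (z - a) powi n)" and r: "r > 0"
  shows "n = 0"
proof -
  obtain g where g: "continuous_on (sphere a r) g" "\<And>z. z \<in> sphere a r \<Longrightarrow> (z - a) powi n = exp (g z)"
    using assms by (auto simp: has_clog_def)
  define c where "c t = a + of_real r * exp (\<i> * of_real t)" for t :: real
  have cs: "c t \<in> sphere a r" for t
    using r by (simp add: c_def dist_norm norm_mult)
  \<comment> \<open>The exponential of \<open>l\<close> is constant, so the values of
    \<open>l\<close> are discrete and \<open>l\<close> is constant. Comparing one full turn shows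
    that \<open>n * \<i> * t\<close> cannot have grown.\<close>
  define l where "l t = g (c t) - of_int n * \<i> * of_real t" for t
  have "continuous_on UNIV c"
    unfolding c_def by (intro continuous_intros)
  then have cl: "continuous_on UNIV l"
    unfolding l_def using cs
    by (intro continuous_intros continuous_on_compose2[OF g(1)]) auto
  have el: "exp (l t) = of_real r powi n" for t
  proof -
    have "exp (l t) = (c t - a) powi n / exp (\<i> * of_real t) powi n"
      using g(2)[OF cs[of t]] by (simp add: l_def exp_diff exp_power_int mult.assoc)
    also have "\<dots> = of_real r powi n"
      by (simp add: c_def power_int_mult_distrib)
    finally show ?thesis .
  qed
  define w where "w t = (l t - l 0) / (2 * pi * \<i>)" for t
  have int: "w t \<in> \<int>" for t
  proof -
    obtain m :: int where "l t = l 0 + (of_int (2 * m) * pi) * \<i>"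
      using el[of t] el[of 0] exp_eq[of "l t" "l 0"] by metis
    then have "w t = of_int m" by (simp add: w_def)
    then show ?thesis by simp
  qed
  have "w constant_on (UNIV::real set)"
  proof (rule continuous_discrete_range_constant)
    show "continuous_on UNIV w"
      unfolding w_def by (intro continuous_intros cl) auto
    show "\<exists>e>0. \<forall>y. y \<in> UNIV \<and> w y \<noteq> w x \<longrightarrow> e \<le> norm (w y - w x)" for x
    proof (intro exI[of _ 1] conjI allI impI)
      fix y assume "y \<in> UNIV \<and> w y \<noteq> w x"
      moreover obtain p q where "w y = of_int p" "w x = of_int q"
        using int by (metis Ints_cases)
      ultimately show "1 \<le> norm (w y - w x)"
        by (simp flip: of_int_diff)
    qed simp
  qed auto
  then have "w (2 * pi) = w 0"
    unfolding constant_on_def by (metis UNIV_I)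
  then have "l (2 * pi) = l 0" by (simp add: w_def)
  moreover have "c (2 * pi) = c 0"
    by (simp add: c_def exp_eq_1)
  ultimately show ?thesis by (simp add: l_def)
qed

text \<open>Outside the component of \<open>a\<close>, a Tietze extension of the logarithm replaces the function without
  introducing zeros or poles. Dividing by \<open>(z - a) powi n\<close> removes the one at \<open>a\<close>, and what remains has a
  logarithm on a large disc.\<close>
lemma has_clog_bounded_component:
  assumes "compact D" "a \<notin> D" "bounded (connected_component_set (- D) a)"
    and q: "continuous_on (D \<union> connected_component_set (- D) a) q"
      "\<And>z. z \<in> D \<union> connected_component_set (- D) a \<Longrightarrow> q z \<noteq> 0"
    and clog: "has_clog D (\<lambda>z. (z - a) powi n * q z)"
  shows "n = 0"
proof -
  let ?C = "connected_component_set (- D) a"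
  have clD: "closed D" using assms(1) compact_imp_closed by blast
  obtain h where h: "continuous_on D h" "\<And>z. z \<in> D \<Longrightarrow> (z - a) powi n * q z = exp (h z)"
    using clog by (auto simp: has_clog_def)
  obtain H where H: "continuous_on UNIV H" "\<And>z. z \<in> D \<Longrightarrow> H z = h z"
    using Tietze_unbounded[OF h(1), of UNIV] clD by auto
  have aC: "a \<in> ?C" using assms(2) by simp
  have opC: "open ?C" using clD by (simp add: open_connected_component open_Compl)
  have clCD: "closed (D \<union> ?C)"
  proof -
    have "- (D \<union> ?C) = \<Union> (components (- D) - {?C})"
      using complement_connected_component_unions[of "- D" a]
      unfolding components_def by blast
    moreover have "open (\<Union> (components (- D) - {?C}))"
    proof (rule open_Union, rule ballI)
      fix S assume "S \<in> components (- D) - {?C}"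
      then show "open S"
        using open_components[of "- D" S] clD by blast
    qed
    ultimately show ?thesis by (simp add: closed_def)
  qed
  obtain R where R: "R > 0" "?C \<subseteq> ball a R"
    using assms(3) by (metis bounded_subset_ballD)
  \<comment> \<open>The two formulas agree on \<open>D\<close> by the choice of \<open>H\<close>,
    and \<open>q\<close> has no zeros, so \<open>G\<close> is continuous and zero-free on the whole
    plane.\<close>
  define G where "G z = (if z \<in> D \<union> ?C then q z else exp (H z) / (z - a) powi n)" for z
  have "continuous_on ((D \<union> ?C) \<union> - ?C) G"
    unfolding G_def
  proof (rule continuous_on_cases)
    show "continuous_on (- ?C) (\<lambda>z. exp (H z) / (z - a) powi n)"
      using aC by (intro continuous_intros continuous_on_subset[OF H(1)]) (auto simp: power_int_eq_0_iff)
    show "\<forall>z. z \<in> D \<union> ?C \<and> z \<notin> D \<union> ?C \<or> z \<in> - ?C \<and> z \<in> D \<union> ?C \<longrightarrow>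
        q z = exp (H z) / (z - a) powi n"
    proof (intro allI impI)
      fix z assume "z \<in> D \<union> ?C \<and> z \<notin> D \<union> ?C \<or> z \<in> - ?C \<and> z \<in> D \<union> ?C"
      then have z: "z \<in> D" by auto
      then have "z \<noteq> a" using assms(2) by auto
      then show "q z = exp (H z) / (z - a) powi n"
        using h(2)[OF z, symmetric] H(2)[OF z] by simp
    qed
  qed (use clCD opC q in auto)
  moreover have "(D \<union> ?C) \<union> - ?C = UNIV" by auto
  ultimately have cG: "continuous_on (cball a R) G"
    by (metis continuous_on_subset subset_UNIV)
  have "G z \<noteq> 0" for z
    using aC q(2) by (auto simp: G_def)
  then obtain L where L: "continuous_on (cball a R) L" "\<And>z. z \<in> cball a R \<Longrightarrow> G z = exp (L z)"
    using continuous_logarithm_on_cball[OF cG] by metis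
  \<comment> \<open>Boundedness of the component puts this circle outside it, where
    \<open>G z * (z - a) powi n = exp (H z)\<close>.\<close>
  have "(z - a) powi n = exp (H z - L z)" if z: "z \<in> sphere a R" for z
  proof -
    have "z \<notin> ?C" "z \<noteq> a" using z R by auto
    have Gz: "G z * (z - a) powi n = exp (H z)"
    proof (cases "z \<in> D")
      case True
      then show ?thesis using h(2)[OF True] H(2)[OF True] by (simp add: G_def mult.commute)
    next
      case False
      then show ?thesis using \<open>z \<notin> ?C\<close> \<open>z \<noteq> a\<close> by (simp add: G_def)
    qed
    have "G z = exp (L z)" using L(2) z by simp
    then show ?thesis
      using Gz by (simp add: exp_diff eq_divide_eq mult.commute)
  qed
  moreover have "continuous_on (sphere a R) (\<lambda>z. H z - L z)"
    by (intro continuous_intros continuous_on_subset[OF H(1)] continuous_on_subset[OF L(1)]) auto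
  ultimately have "has_clog (sphere a R) (\<lambda>z. (z - a) powi n)"
    unfolding has_clog_def by blast
  then show ?thesis using has_clog_powi_circle R(1) by blast
qed

lemma arc_punctured:
  assumes "arc g"
  shows "path_image g - {pathstart g, pathfinish g} \<noteq> {}"
    and "connected (path_image g - {pathstart g, pathfinish g})"
proof -
  show "connected (path_image g - {pathstart g, pathfinish g})"
    by (rule connected_simple_path_endless) (rule arc_imp_simple_path[OF assms])
  have "inj_on g {0..1}" using assms by (simp add: arc_def)
  have "g (1/2) \<in> path_image g" by (simp add: path_image_def)
  have "g (1/2) \<noteq> g 0" "g (1/2) \<noteq> g 1" by (use \<open>inj_on g {0..1}\<close> in \<open>auto dest!: inj_onD\<close>)
  then show "path_image g - {pathstart g, pathfinish g} \<noteq> {}"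
    using \<open>g (1/2) \<in> path_image g\<close> by (auto simp: pathstart_def pathfinish_def)
qed

text \<open>The logarithms of a Borsuk map on the two pieces, normalised at one common point, differ at the
  other one by an integral multiple of \<open>2 \<pi> i\<close>.\<close>
lemma log_discrepancy:
  assumes "has_clog K f" "has_clog L f" "x \<in> K \<inter> L" "y \<in> K \<inter> L"
  obtains g h m where "continuous_on K g" "\<And>z. z \<in> K \<Longrightarrow> f z = exp (g z)"
    "continuous_on L h" "\<And>z. z \<in> L \<Longrightarrow> f z = exp (h z)"
    "g x = h x" "g y = h y + 2 * of_int m * of_real pi * \<i>"
proof -
  obtain g where g: "continuous_on K g" "\<And>z. z \<in> K \<Longrightarrow> f z = exp (g z)"
    using assms(1) by (auto simp: has_clog_def)
  obtain h where h: "continuous_on L h" "\<And>z. z \<in> L \<Longrightarrow> f z = exp (h z)"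
    using assms(2) by (auto simp: has_clog_def)
  have exp_eq_gh: "exp (g z) = exp (h z)" if "z \<in> K \<inter> L" for z
    using g(2)[of z] h(2)[of z] that by auto
  define h' where "h' z = h z + (g x - h x)" for z
  have "exp (g x - h x) = 1"
    using exp_eq_gh[OF assms(3)] by (simp add: exp_diff)
  then have h': "exp (h' z) = exp (h z)" for z
    by (simp add: h'_def exp_add)
  have "exp (g y) = exp (h' y)"
    using exp_eq_gh[OF assms(4)] h' by simp
  then obtain m :: int where m: "g y = h' y + (of_int (2 * m) * pi) * \<i>"
    unfolding exp_eq by blast
  show thesis
  proof
    show "continuous_on L h'" unfolding h'_def by (intro continuous_intros h)
    show "f z = exp (h' z)" if "z \<in> L" for z using h(2)[OF that] h' by simp
    show "g x = h' x" by (simp add: h'_def)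
    show "g y = h' y + 2 * of_int m * of_real pi * \<i>" using m by simp
  qed (use g in auto)
qed

text \<open>The discrepancies of the Borsuk maps of two pairs of the three points are integers, so some
  product of powers of these maps has a logarithm on \<open>K \<union> path_image A\<close>.\<close>
lemma arc_meets_at_most_two_faces:
  fixes A :: "real \<Rightarrow> complex"
  assumes K: "compact K" and A: "arc A"
    and KA: "K \<inter> path_image A = {pathstart A, pathfinish A}"
    and D: "D = K \<union> path_image A"
    and touch: "\<And>c. c \<in> {a1, a2, a3} \<Longrightarrow>
        closure (connected_component_set (- D) c) \<inter> (path_image A - {pathstart A, pathfinish A}) \<noteq> {}"
    and sep: "\<not> connected_component (- D) a1 a2" "\<not> connected_component (- D) a1 a3"
      "\<not> connected_component (- D) a2 a3"
  shows False
proof -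
  let ?A = "path_image A" and ?I = "path_image A - {pathstart A, pathfinish A}"
  let ?F = "\<lambda>c. connected_component_set (- D) c"
  have compA: "compact ?A" and cD: "compact D"
    using A K D by (auto simp: compact_arc_image)
  have clK: "closed K" and clA: "closed ?A" and clD: "closed D"
    using K compA cD compact_imp_closed by auto
  have nD: "c \<notin> D" if "c \<in> {a1, a2, a3}" for c
  proof -
    have "?F c \<noteq> {}" using touch[OF that] by (metis closure_empty Int_empty_left)
    then show ?thesis unfolding connected_component_eq_empty by simp
  qed
  \<comment> \<open>A face whose closure reaches the open arc stays connected when the open arc is
    added. Erasing the arc therefore merges all three faces.\<close>
  have near: "connected (?F c \<union> ?I) \<and> ?F c \<union> ?I \<subseteq> - K" if c: "c \<in> {a1, a2, a3}" for c
  proof -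
    obtain u where u: "u \<in> closure (?F c)" "u \<in> ?I" using touch[OF c] by blast
    have "connected (insert u (?F c))"
      by (rule connected_intermediate_closure[of "?F c"])
        (use u(1) closure_subset[of "?F c"] in \<open>simp_all add: subset_insertI\<close>)
    moreover have "connected ?I" using arc_punctured(2)[OF A] .
    ultimately have "connected (insert u (?F c) \<union> ?I)"
      using u(2) by (intro connected_Un) auto
    moreover have "insert u (?F c) \<union> ?I = ?F c \<union> ?I" using u(2) by auto
    moreover have "?F c \<subseteq> - K" "?I \<subseteq> - K"
      using connected_component_subset[of "- D" c] KA D by blast+
    ultimately show ?thesis by (metis Un_least)
  qed
  have ccK: "connected_component (- K) c d" if c: "c \<in> {a1, a2, a3}" and d: "d \<in> {a1, a2, a3}" for c d
  proof -
    have "connected ((?F c \<union> ?I) \<union> (?F d \<union> ?I))"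
    proof (rule connected_Un)
      show "(?F c \<union> ?I) \<inter> (?F d \<union> ?I) \<noteq> {}"
        using arc_punctured(1)[OF A] by blast
    qed (use near[OF c] near[OF d] in blast)+
    moreover have "c \<in> (?F c \<union> ?I) \<union> (?F d \<union> ?I)" "d \<in> (?F c \<union> ?I) \<union> (?F d \<union> ?I)"
      using nD[OF c] nD[OF d] by simp_all
    moreover have "(?F c \<union> ?I) \<union> (?F d \<union> ?I) \<subseteq> - K" using near[OF c] near[OF d] by simp
    ultimately show ?thesis
      by (metis connected_componentI)
  qed
  have ccA: "connected_component (- ?A) c d" if "c \<in> {a1, a2, a3}" "d \<in> {a1, a2, a3}" for c d
    using connected_arc_complement[OF A] nD[OF that(1)] nD[OF that(2)] D
    unfolding connected_iff_connected_component by auto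
  have ends: "pathstart A \<in> K \<inter> ?A" "pathfinish A \<in> K \<inter> ?A" using KA by auto
  define f where "f d z = (z - a1) / (z - d)" for d z :: complex
  have lK: "has_clog K (f d)" and lA: "has_clog ?A (f d)" if "d \<in> {a1, a2, a3}" for d
    unfolding f_def using that
    by (auto intro!: has_clog_divide_same_component clK clA ccK ccA)
  obtain g2 h2 m2 where g2: "continuous_on K g2" "\<And>z. z \<in> K \<Longrightarrow> f a2 z = exp (g2 z)"
    and h2: "continuous_on ?A h2" "\<And>z. z \<in> ?A \<Longrightarrow> f a2 z = exp (h2 z)"
    and e2: "g2 (pathstart A) = h2 (pathstart A)"
      "g2 (pathfinish A) = h2 (pathfinish A) + 2 * of_int m2 * of_real pi * \<i>"
    by (rule log_discrepancy[OF lK[of a2] lA[of a2] ends]) auto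
  obtain g3 h3 m3 where g3: "continuous_on K g3" "\<And>z. z \<in> K \<Longrightarrow> f a3 z = exp (g3 z)"
    and h3: "continuous_on ?A h3" "\<And>z. z \<in> ?A \<Longrightarrow> f a3 z = exp (h3 z)"
    and e3: "g3 (pathstart A) = h3 (pathstart A)"
      "g3 (pathfinish A) = h3 (pathfinish A) + 2 * of_int m3 * of_real pi * \<i>"
    by (rule log_discrepancy[OF lK[of a3] lA[of a3] ends]) auto
  \<comment> \<open>The combined discrepancy vanishes, while at least two of the exponents
    \<open>p + q\<close>, \<open>- p\<close>, \<open>- q\<close> belonging to the three points are
    nonzero.\<close>
  obtain p q :: int where pq: "p * m2 + q * m3 = 0"
    "p \<noteq> 0 \<and> q \<noteq> 0 \<or> p + q \<noteq> 0 \<and> q \<noteq> 0 \<or> p + q \<noteq> 0 \<and> p \<noteq> 0"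
  proof (cases "m2 = 0 \<or> m3 = 0")
    case True
    then show thesis using that[of 1 0] that[of 0 1] by auto
  next
    case False
    then show thesis using that[of m3 "- m2"] by auto
  qed
  \<comment> \<open>The two branches meet only in the ends of \<open>A\<close>. They agree at the
    first by normalisation and at the second by the choice of \<open>p\<close> and
    \<open>q\<close>.\<close>
  define G where "G z = (if z \<in> K then of_int p * g2 z + of_int q * g3 z
    else of_int p * h2 z + of_int q * h3 z)" for z
  have "continuous_on (K \<union> ?A) G"
    unfolding G_def
  proof (rule continuous_on_cases)
    show "\<forall>z. z \<in> K \<and> z \<notin> K \<or> z \<in> ?A \<and> z \<in> K \<longrightarrow>
        of_int p * g2 z + of_int q * g3 z = of_int p * h2 z + of_int q * h3 z"
    proof (intro allI impI)
      fix z assume "z \<in> K \<and> z \<notin> K \<or> z \<in> ?A \<and> z \<in> K"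
      then consider "z = pathstart A" | "z = pathfinish A" using KA by blast
      then show "of_int p * g2 z + of_int q * g3 z = of_int p * h2 z + of_int q * h3 z"
      proof cases
        case 2
        have "of_int p * g2 z + of_int q * g3 z
            = of_int p * h2 z + of_int q * h3 z + 2 * of_int (p * m2 + q * m3) * of_real pi * \<i>"
          unfolding 2 e2 e3 by (simp add: algebra_simps)
        then show ?thesis using pq(1) by simp
      qed (simp add: e2 e3)
    qed
  qed (intro clK clA continuous_intros g2 g3 h2 h3)+
  then have cG: "continuous_on D G" using D by simp
  have eG: "exp (G z) = f a2 z powi p * f a3 z powi q" if z: "z \<in> D" for z
  proof (cases "z \<in> K")
    case True
    then show ?thesis by (simp add: G_def exp_add exp_power_int g2(2) g3(2))
  next
    case False
    then have "z \<in> ?A" using z D by auto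
    then show ?thesis using False by (simp add: G_def exp_add exp_power_int h2(2) h3(2))
  qed
  have eG': "exp (G z) = (z - a1) powi (p + q) * (z - a2) powi (- p) * (z - a3) powi (- q)"
    if z: "z \<in> D" for z
  proof -
    have "z - a1 \<noteq> 0" "z - a2 \<noteq> 0" "z - a3 \<noteq> 0" using nD z by auto
    then show ?thesis
      unfolding eG[OF z] f_def power_int_divide_distrib
      by (simp add: power_int_add power_int_minus field_simps)
  qed
  have disj: "z - d \<noteq> 0" if "z \<in> D \<union> ?F c" "\<not> connected_component (- D) c d" "d \<in> {a1, a2, a3}" for z c d
    using that nD[OF that(3)] by (metis UnE eq_iff_diff_eq_0 mem_Collect_eq)
  have sep': "\<not> connected_component (- D) a2 a1" "\<not> connected_component (- D) a3 a1"
      "\<not> connected_component (- D) a3 a2"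
    using sep connected_component_sym by blast+
  \<comment> \<open>The product has a logarithm on \<open>D\<close>, so it can have no zero or pole
    in a bounded face: the exponent at the point of that face is 0.\<close>
  have b1: "p + q = 0" if "bounded (?F a1)"
  proof (rule has_clog_bounded_component[OF cD _ that])
    show "has_clog D (\<lambda>z. (z - a1) powi (p + q) * ((z - a2) powi (- p) * (z - a3) powi (- q)))"
      unfolding has_clog_def using cG eG' by (intro exI[of _ G]) (simp add: mult.assoc)
    show "continuous_on (D \<union> ?F a1) (\<lambda>z. (z - a2) powi (- p) * (z - a3) powi (- q))"
      using disj[of _ a1 a2] disj[of _ a1 a3] sep sep'
      by (intro continuous_intros disjI2 ballI) simp_all
    show "(z - a2) powi (- p) * (z - a3) powi (- q) \<noteq> 0" if "z \<in> D \<union> ?F a1" for z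
      using disj[OF that, of a2] disj[OF that, of a3] sep sep' by simp
  qed (use nD in auto)
  have b2: "p = 0" if "bounded (?F a2)"
  proof -
    have "- p = 0"
    proof (rule has_clog_bounded_component[OF cD _ that])
      show "has_clog D (\<lambda>z. (z - a2) powi (- p) * ((z - a1) powi (p + q) * (z - a3) powi (- q)))"
        unfolding has_clog_def using cG eG' by (intro exI[of _ G]) (simp add: mult_ac)
      show "continuous_on (D \<union> ?F a2) (\<lambda>z. (z - a1) powi (p + q) * (z - a3) powi (- q))"
        using disj[of _ a2 a1] disj[of _ a2 a3] sep sep'
      by (intro continuous_intros disjI2 ballI) simp_all
      show "(z - a1) powi (p + q) * (z - a3) powi (- q) \<noteq> 0" if "z \<in> D \<union> ?F a2" for z
        using disj[OF that, of a1] disj[OF that, of a3] sep sep' by simp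
    qed (use nD in auto)
    then show ?thesis by simp
  qed
  have b3: "q = 0" if "bounded (?F a3)"
  proof -
    have "- q = 0"
    proof (rule has_clog_bounded_component[OF cD _ that])
      show "has_clog D (\<lambda>z. (z - a3) powi (- q) * ((z - a1) powi (p + q) * (z - a2) powi (- p)))"
        unfolding has_clog_def using cG eG' by (intro exI[of _ G]) (simp add: mult_ac)
      show "continuous_on (D \<union> ?F a3) (\<lambda>z. (z - a1) powi (p + q) * (z - a2) powi (- p))"
        using disj[of _ a3 a1] disj[of _ a3 a2] sep sep'
      by (intro continuous_intros disjI2 ballI) simp_all
      show "(z - a1) powi (p + q) * (z - a2) powi (- p) \<noteq> 0" if "z \<in> D \<union> ?F a3" for z
        using disj[OF that, of a1] disj[OF that, of a2] sep sep' by simp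
    qed (use nD in auto)
    then show ?thesis by simp
  qed
  \<comment> \<open>Only one face is unbounded, so at least two of the three exponents vanish,
    against the choice of \<open>p\<close> and \<open>q\<close>.\<close>
  have unb: "bounded (?F c) \<or> bounded (?F d)"
    if "c \<in> {a1, a2, a3}" "d \<in> {a1, a2, a3}" "\<not> connected_component (- D) c d" for c d
  proof (rule ccontr)
    assume "\<not> ?thesis"
    then have "?F c = ?F d"
      using cobounded_unique_unbounded_component[of "- D" c d] compact_imp_bounded[OF cD] by auto
    then show False
      using that nD[OF that(2)] connected_component_eq_eq[of "- D" c d] by auto
  qed
  show False
    using pq(2) b1 b2 b3 unb[of a1 a2] unb[of a1 a3] unb[of a2 a3] sep by auto
qed

subsection \<open>An arc that closes a cycle creates a face\<close>

text \<open>At most one point of \<open>P\<close> lies in the face through which the arc runs; \<open>Q\<close> replaces it.\<close>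
lemma add_arc_separated_points:
  fixes A :: "real \<Rightarrow> complex"
  assumes K: "compact K" and A: "arc A" and KA: "K \<inter> path_image A = {pathstart A, pathfinish A}"
    and P: "finite P" "P \<inter> K = {}" "pairwise (\<lambda>a b. \<not> connected_component (- K) a b) P"
    and Q: "finite Q" "Q \<noteq> {}" "Q \<inter> path_image A = {}"
      "Q \<subseteq> connected_component_set (- K) z"
      "pairwise (\<lambda>a b. \<not> connected_component (- (K \<union> path_image A)) a b) Q"
    and z: "z \<in> path_image A - {pathstart A, pathfinish A}"
  obtains P' where "finite P'" "P' \<inter> (K \<union> path_image A) = {}"
    "pairwise (\<lambda>a b. \<not> connected_component (- (K \<union> path_image A)) a b) P'"
    "card P + card Q \<le> card P' + 1"
proof -
  let ?f = "connected_component_set (- K) z" and ?I = "path_image A - {pathstart A, pathfinish A}"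
  define P0 where "P0 = P - ?f"
  \<comment> \<open>The open arc is connected and misses \<open>K\<close>, so it lies in a single
    old face, and points of \<open>P\<close> in other faces avoid it.\<close>
  have If: "?I \<subseteq> ?f"
    using z arc_punctured(2)[OF A] KA by (intro connected_component_maximal) auto
  have sub: "connected_component (- K) a b" if "connected_component (- (K \<union> path_image A)) a b" for a b
    using that connected_component_of_subset by fastforce
  have fK: "?f \<subseteq> - K" by (rule connected_component_subset)
  have "P \<inter> path_image A \<subseteq> ?f"
    using If KA P(2) by blast
  then have P0: "P0 \<inter> (K \<union> path_image A) = {}"
    using P(2) by (auto simp: P0_def)
  have cross: "\<not> connected_component (- (K \<union> path_image A)) a b"
    "\<not> connected_component (- (K \<union> path_image A)) b a" if "a \<in> P0" "b \<in> Q" for a b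
  proof -
    have "connected_component (- K) z b" using Q(4) that(2) by auto
    then have "\<not> connected_component (- K) a b" "\<not> connected_component (- K) b a"
      using that(1) unfolding P0_def
      by (metis DiffD2 connected_component_sym connected_component_trans mem_Collect_eq)+
    then show "\<not> connected_component (- (K \<union> path_image A)) a b"
      "\<not> connected_component (- (K \<union> path_image A)) b a" using sub by blast+
  qed
  have "a = b" if ab: "a \<in> P \<inter> ?f" "b \<in> P \<inter> ?f" for a b
  proof (rule ccontr)
    assume "a \<noteq> b"
    have "connected_component (- K) z a" "connected_component (- K) z b" using ab by auto
    then have "connected_component (- K) a b"
      using connected_component_sym connected_component_trans by metis
    then show False using P(3) ab \<open>a \<noteq> b\<close> by (auto simp: pairwise_def)
  qed
  then have "card (P \<inter> ?f) \<le> Suc 0"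
    using card_le_Suc0_iff_eq[of "P \<inter> ?f"] P(1) by blast
  moreover have "card P = card P0 + card (P \<inter> ?f)"
    unfolding P0_def using P(1) by (metis card_Int_Diff add.commute finite_subset)
  moreover have "card (P0 \<union> Q) = card P0 + card Q"
    using P(1) Q(1,4) by (intro card_Un_disjoint) (auto simp: P0_def)
  ultimately have "card P + card Q \<le> card (P0 \<union> Q) + 1" by simp
  moreover have "pairwise (\<lambda>a b. \<not> connected_component (- (K \<union> path_image A)) a b) (P0 \<union> Q)"
    unfolding pairwise_def
  proof (intro ballI impI)
    fix a b assume ab: "a \<in> P0 \<union> Q" "b \<in> P0 \<union> Q" "a \<noteq> b"
    show "\<not> connected_component (- (K \<union> path_image A)) a b"
    proof (cases "a \<in> Q \<longleftrightarrow> b \<in> Q")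
      case True
      then consider "a \<in> Q" "b \<in> Q" | "a \<in> P" "b \<in> P" using ab by (auto simp: P0_def)
      then show ?thesis
      proof cases
        case 1
        then show ?thesis using pairwiseD[OF Q(5)] ab(3) by blast
      next
        case 2
        then show ?thesis using pairwiseD[OF P(3)] ab(3) sub by blast
      qed
    qed (use ab cross in auto)
  qed
  moreover have "finite (P0 \<union> Q)" using P(1) Q(1) by (auto simp: P0_def)
  moreover have "(P0 \<union> Q) \<inter> (K \<union> path_image A) = {}"
    using P0 Q(3,4) fK by blast
  ultimately show thesis using that by blast
qed

text \<open>Otherwise the open arc would be an open set, and the plane without the two end points would fall
  apart into the open arc and the complement of the closed arc.\<close>
lemma component_not_subset_arc:
  fixes A :: "real \<Rightarrow> complex"
  assumes K: "closed K" and A: "arc A" and KA: "K \<inter> path_image A = {pathstart A, pathfinish A}"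
    and z: "z \<in> path_image A - {pathstart A, pathfinish A}"
  shows "\<not> connected_component_set (- K) z \<subseteq> path_image A"
proof
  let ?f = "connected_component_set (- K) z" and ?I = "path_image A - {pathstart A, pathfinish A}"
  assume sub: "?f \<subseteq> path_image A"
  have "?I \<subseteq> ?f"
    using z arc_punctured(2)[OF A] KA by (intro connected_component_maximal) auto
  moreover have "?f \<subseteq> - K" by (rule connected_component_subset)
  ultimately have fI: "?f = ?I" using sub KA by blast
  have "open ?I" using K unfolding fI[symmetric] by (simp add: open_connected_component open_Compl)
  have cA: "compact (path_image A)" using A by (simp add: compact_arc_image)
  then have "open (- path_image A)" by (simp add: compact_imp_closed open_Compl)
  have ne: "- path_image A \<noteq> {}"
    using compact_imp_bounded[OF cA] not_bounded_UNIV by (metis Compl_UNIV_eq double_compl)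
  have "connected (UNIV - {pathstart A, pathfinish A})"
    by (intro connected_open_delete_finite) auto
  then show False
    using connectedD[of "UNIV - {pathstart A, pathfinish A}" ?I "- path_image A"]
      \<open>open ?I\<close> \<open>open (- path_image A)\<close> ne z by (auto simp del: Compl_eq_Diff_UNIV)
qed

text \<open>An arc \<open>B\<close> inside \<open>K\<close> joins the ends of \<open>A\<close> and
  closes it to a Jordan curve. As \<open>z\<close> is a limit of both sides, the open face around
  \<open>z\<close> contains points of both, and these can no longer be joined once \<open>A\<close>
  is added.\<close>

lemma arc_splits_component:
  fixes A :: "real \<Rightarrow> complex"
  assumes K: "closed K" and A: "arc A" and KA: "K \<inter> path_image A = {pathstart A, pathfinish A}"
    and con: "path_component K (pathstart A) (pathfinish A)"
    and z: "z \<in> path_image A - {pathstart A, pathfinish A}"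
  obtains p q where "p \<in> connected_component_set (- K) z - path_image A"
    "q \<in> connected_component_set (- K) z - path_image A"
    "\<not> connected_component (- (K \<union> path_image A)) p q"
proof -
  let ?f = "connected_component_set (- K) z"
  have ne: "pathstart A \<noteq> pathfinish A" using arc_distinct_ends[OF A] by simp
  obtain g where g: "path g" "path_image g \<subseteq> K" "pathstart g = pathstart A" "pathfinish g = pathfinish A"
    using con by (auto simp: path_component_def)
  obtain B where B: "arc B" "path_image B \<subseteq> path_image g" "pathstart B = pathstart A" "pathfinish B = pathfinish A"
    using path_contains_arc[OF g(1,3,4) ne] by metis
  let ?c = "A +++ reversepath B"
  have c: "simple_path ?c" "pathfinish ?c = pathstart ?c"
    using A B g KA by (auto simp: simple_path_join_loop_eq arc_reversepath)
  have J: "path_image ?c = path_image A \<union> path_image B"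
    using B by (simp add: path_image_join)
  have zf: "z \<in> ?f" using z KA by auto
  have opf: "open ?f" using K by (simp add: open_connected_component open_Compl)
  have fr: "z \<in> closure (inside (path_image ?c))" "z \<in> closure (outside (path_image ?c))"
    using Jordan_inside_outside[OF c] z unfolding J frontier_def by blast+
  obtain p where p: "p \<in> ?f" "p \<in> inside (path_image ?c)"
    using fr(1) opf zf open_Int_closure_eq_empty by blast
  obtain q where q: "q \<in> ?f" "q \<in> outside (path_image ?c)"
    using fr(2) opf zf open_Int_closure_eq_empty by blast
  have "\<not> connected_component (- (K \<union> path_image A)) p q"
  proof
    assume "connected_component (- (K \<union> path_image A)) p q"
    moreover have "- (K \<union> path_image A) \<subseteq> - path_image ?c"
      using B(2) g(2) unfolding J by blast
    ultimately have "connected_component (- path_image ?c) p q"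
      using connected_component_of_subset by blast
    then have "q \<in> inside (path_image ?c)"
      using p(2) inside_same_component by blast
    then show False using q(2) Jordan_inside_outside[OF c] by blast
  qed
  moreover have "p \<notin> path_image A" "q \<notin> path_image A"
    using p(2) q(2) inside_no_overlap outside_no_overlap unfolding J by blast+
  ultimately show thesis using p q that by blast
qed

text \<open>The inductive step of Euler's formula. The ends have to be joined by a path in
  \<open>K\<close>, and not merely lie in one connected component, because the Jordan curve is built
  from that path.\<close>

lemma add_arc_faces:
  fixes A :: "real \<Rightarrow> complex"
  assumes K: "compact K" and A: "arc A" and KA: "K \<inter> path_image A = {pathstart A, pathfinish A}"
    and P: "finite P" "P \<inter> K = {}" "pairwise (\<lambda>a b. \<not> connected_component (- K) a b) P"
  shows "\<exists>P'. finite P' \<and> P' \<inter> (K \<union> path_image A) = {} \<and>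
    pairwise (\<lambda>a b. \<not> connected_component (- (K \<union> path_image A)) a b) P' \<and>
    card P + (if path_component K (pathstart A) (pathfinish A) then 1 else 0) \<le> card P'"
proof -
  have clK: "closed K" using K compact_imp_closed by blast
  obtain z where z: "z \<in> path_image A - {pathstart A, pathfinish A}"
    using arc_punctured(1)[OF A] by blast
  show ?thesis
  proof (cases "path_component K (pathstart A) (pathfinish A)")
    case True
    obtain p q where pq: "p \<in> connected_component_set (- K) z - path_image A"
        "q \<in> connected_component_set (- K) z - path_image A"
        "\<not> connected_component (- (K \<union> path_image A)) p q"
      using arc_splits_component[OF clK A KA True z] by blast
    have fK: "connected_component_set (- K) z \<subseteq> - K" by (rule connected_component_subset)
    then have "p \<notin> K \<union> path_image A" using pq(1) by blast
    then have "p \<noteq> q" using pq(3) by auto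
    have "pairwise (\<lambda>a b. \<not> connected_component (- (K \<union> path_image A)) a b) {p, q}"
      using pq(3) connected_component_sym[of "- (K \<union> path_image A)" q p] by (auto simp: pairwise_def)
    note sep = this
    have Q: "{p, q} \<inter> path_image A = {}" "{p, q} \<subseteq> connected_component_set (- K) z"
      using pq(1,2) by blast+
    obtain P' where "finite P'" "P' \<inter> (K \<union> path_image A) = {}"
      "pairwise (\<lambda>a b. \<not> connected_component (- (K \<union> path_image A)) a b) P'"
      "card P + card {p, q} \<le> card P' + 1"
      by (rule add_arc_separated_points[OF K A KA P _ _ Q sep z]) simp_all
    then show ?thesis using True \<open>p \<noteq> q\<close> by auto
  next
    case False
    obtain p where p: "p \<in> connected_component_set (- K) z - path_image A"
      using component_not_subset_arc[OF clK A KA z] by blast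
    have Q: "{p} \<inter> path_image A = {}" "{p} \<subseteq> connected_component_set (- K) z"
      using p by blast+
    obtain P' where "finite P'" "P' \<inter> (K \<union> path_image A) = {}"
      "pairwise (\<lambda>a b. \<not> connected_component (- (K \<union> path_image A)) a b) P'"
      "card P + card {p} \<le> card P' + 1"
      by (rule add_arc_separated_points[OF K A KA P _ _ Q _ z]) simp_all
    then show ?thesis using False by auto
  qed
qed

subsection \<open>Drawings with clusters as vertices\<close>

text \<open>A vertex \<open>x\<close> is drawn as the set \<open>X x\<close>, which may be thought of as a drawn tree.\<close>
locale cluster_drawing =
  fixes V :: "'a set" and E :: "'a set set" and X :: "'a \<Rightarrow> complex set"
    and A :: "'a set \<Rightarrow> real \<Rightarrow> complex"
  assumes finite_V: "finite V"
    and compact_X: "x \<in> V \<Longrightarrow> compact (X x)"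
    and path_connected_X: "x \<in> V \<Longrightarrow> path_connected (X x)"
    and connected_compl_X: "x \<in> V \<Longrightarrow> connected (- X x)"
    and disjoint_X: "x \<in> V \<Longrightarrow> y \<in> V \<Longrightarrow> x \<noteq> y \<Longrightarrow> X x \<inter> X y = {}"
    and edge_subset: "e \<in> E \<Longrightarrow> e \<subseteq> V"
    and card_edge: "e \<in> E \<Longrightarrow> card e = 2"
    and arc_A: "e \<in> E \<Longrightarrow> arc (A e)"
    and A_Int_clusters: "e \<in> E \<Longrightarrow> path_image (A e) \<inter> (\<Union>x\<in>V. X x) = {pathstart (A e), pathfinish (A e)}"
    and A_Int_end: "e \<in> E \<Longrightarrow> x \<in> e \<Longrightarrow> \<exists>q. path_image (A e) \<inter> X x = {q}"
    and A_Int_other: "e \<in> E \<Longrightarrow> x \<in> V \<Longrightarrow> x \<notin> e \<Longrightarrow> path_image (A e) \<inter> X x = {}"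
    and A_Int_A: "e \<in> E \<Longrightarrow> f \<in> E \<Longrightarrow> e \<noteq> f \<Longrightarrow>
      path_image (A e) \<inter> path_image (A f) \<subseteq> (\<Union>x\<in>e \<inter> f. X x)"
begin

lemma finite_E: "finite E"
  using edge_subset finite_V by (meson Pow_iff finite_Pow_iff finite_subset subsetI)

definition body :: "'a set \<Rightarrow> 'a set set \<Rightarrow> complex set" where
  "body W S = (\<Union>x\<in>W. X x) \<union> (\<Union>e\<in>S. path_image (A e))"

lemma compact_body: "W \<subseteq> V \<Longrightarrow> S \<subseteq> E \<Longrightarrow> compact (body W S)"
  unfolding body_def using finite_V finite_E
  by (intro compact_Un compact_UN) (auto intro: finite_subset compact_X compact_arc_image arc_A)

lemma body_insert: "body W (insert e S) = body W S \<union> path_image (A e)"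
  by (auto simp: body_def)

text \<open>Other arcs meet \<open>A e\<close> only inside clusters, and clusters meet it only in
  its ends. This is the hypothesis of the lemmas about adding or erasing one arc.\<close>

lemma body_Int_A:
  assumes "e \<in> E" "S \<subseteq> E" "e \<notin> S"
  shows "body V S \<inter> path_image (A e) = {pathstart (A e), pathfinish (A e)}"
proof -
  have "path_image (A f) \<inter> path_image (A e) \<subseteq> (\<Union>x\<in>V. X x)" if "f \<in> S" for f
    using A_Int_A[of f e] assms that edge_subset[OF assms(1)] by blast
  then have "body V S \<inter> path_image (A e) = path_image (A e) \<inter> (\<Union>x\<in>V. X x)"
    unfolding body_def by blast
  then show ?thesis using A_Int_clusters[OF assms(1)] by simp
qed

text \<open>The locale gives the ends only as an unordered set of points. They lie in different
  clusters because the arc meets each cluster of \<open>e\<close> in a single point.\<close>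

lemma edge_ends:
  assumes "e \<in> E"
  obtains x y where "e = {x, y}" "x \<noteq> y" "x \<in> V" "y \<in> V"
    "pathstart (A e) \<in> X x" "pathfinish (A e) \<in> X y"
proof -
  have *: "\<exists>x\<in>e. p \<in> X x" if "p \<in> {pathstart (A e), pathfinish (A e)}" for p
    using A_Int_clusters[OF assms] A_Int_other[OF assms] that by blast
  obtain x where x: "x \<in> e" "pathstart (A e) \<in> X x" using * by blast
  obtain y where y: "y \<in> e" "pathfinish (A e) \<in> X y" using * by blast
  have ne: "pathfinish (A e) \<noteq> pathstart (A e)" using arc_distinct_ends[OF arc_A[OF assms]] .
  have "x \<noteq> y"
  proof
    assume "x = y"
    then have "{pathstart (A e), pathfinish (A e)} \<subseteq> path_image (A e) \<inter> X x" using x y by auto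
    moreover obtain q where "path_image (A e) \<inter> X x = {q}" using A_Int_end[OF assms x(1)] by blast
    ultimately show False using ne by auto
  qed
  moreover have "e = {x, y}"
    using x(1) y(1) calculation card_edge[OF assms] by (auto simp: card_2_iff)
  ultimately show thesis using that x y edge_subset[OF assms] by blast
qed

text \<open>The faces are counted by a set \<open>P\<close> of points in different faces, and the map \<open>c\<close> labels the
  components of the graph as in a union-find algorithm.\<close>
lemma many_faces:
  assumes "S \<subseteq> E"
  shows "\<exists>c :: 'a \<Rightarrow> 'a. \<exists>P. (\<forall>x\<in>V. \<forall>y\<in>V. c x = c y \<longrightarrow> (\<forall>p\<in>X x. \<forall>q\<in>X y. path_component (body V S) p q))
    \<and> finite P \<and> P \<inter> body V S = {} \<and> pairwise (\<lambda>a b. \<not> connected_component (- body V S) a b) P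
    \<and> 1 + card S + card (c ` V) \<le> card P + card V"
  using finite_subset[OF assms finite_E] assms
proof (induction S rule: finite_induct)
  case empty
  have "path_component (body V {}) p q" if "x \<in> V" "p \<in> X x" "q \<in> X x" for x p q
  proof -
    have "path_component (X x) p q"
      using path_connected_X[OF that(1)] that(2,3) by (simp add: path_connected_component)
    then show ?thesis
      by (rule path_component_of_subset[rotated]) (use that(1) in \<open>auto simp: body_def\<close>)
  qed
  \<comment> \<open>One point off the clusters represents the only face of a drawing without
    edges.\<close>
  moreover obtain p where "p \<notin> body V {}"
    using compact_imp_bounded[OF compact_body[of V "{}"]] not_bounded_UNIV
    by (metis UNIV_eq_I empty_subsetI subset_refl)
  moreover have "card (id ` V) = card V" by simp
  ultimately show ?case
    by (intro exI[of _ id] exI[of _ "{p}"]) simp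
next
  case (insert e S)
  then have e: "e \<in> E" and S: "S \<subseteq> E" by auto
  obtain c :: "'a \<Rightarrow> 'a" and P where
    c: "\<And>x y p q. x \<in> V \<Longrightarrow> y \<in> V \<Longrightarrow> c x = c y \<Longrightarrow> p \<in> X x \<Longrightarrow> q \<in> X y \<Longrightarrow> path_component (body V S) p q"
    and P: "finite P" "P \<inter> body V S = {}" "pairwise (\<lambda>a b. \<not> connected_component (- body V S) a b) P"
    and card: "1 + card S + card (c ` V) \<le> card P + card V"
    using insert.IH[OF S] by blast
  obtain x y where xy: "e = {x, y}" "x \<noteq> y" "x \<in> V" "y \<in> V"
    "pathstart (A e) \<in> X x" "pathfinish (A e) \<in> X y"
    using edge_ends[OF e] by blast
  let ?D = "body V S" and ?D' = "body V (insert e S)"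
  have sub: "path_component ?D' p q" if "path_component ?D p q" for p q
    using that by (rule path_component_of_subset[rotated]) (auto simp: body_insert)
  obtain P' where P': "finite P'" "P' \<inter> ?D' = {}" "pairwise (\<lambda>a b. \<not> connected_component (- ?D') a b) P'"
    "card P + (if path_component ?D (pathstart (A e)) (pathfinish (A e)) then 1 else 0) \<le> card P'"
    using add_arc_faces[OF compact_body[OF subset_refl S] arc_A[OF e] body_Int_A[OF e S insert.hyps(2)] P]
    unfolding body_insert by blast
  show ?case
  proof (cases "c x = c y")
    case True
    then have "path_component ?D (pathstart (A e)) (pathfinish (A e))" using c xy by blast
    then have "1 + card (insert e S) + card (c ` V) \<le> card P' + card V"
      using P'(4) card insert.hyps by simp
    moreover have "\<forall>x\<in>V. \<forall>y\<in>V. c x = c y \<longrightarrow> (\<forall>p\<in>X x. \<forall>q\<in>X y. path_component ?D' p q)"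
      using c sub by blast
    ultimately show ?thesis using P'(1-3) by blast
  next
    case False
    \<comment> \<open>The class of \<open>x\<close> takes over the label of \<open>y\<close>. The
      label that disappears pays for an edge that need not create a face.\<close>
    define d where "d z = (if c z = c x then c y else c z)" for z
    have "d ` V \<subseteq> c ` V - {c x}" using False xy by (auto simp: d_def)
    then have "card (d ` V) \<le> card (c ` V - {c x})" using finite_V by (intro card_mono) auto
    also have "card (c ` V - {c x}) = card (c ` V) - 1" using xy(3) by (intro card_Diff_singleton) auto
    finally have "card (d ` V) + 1 \<le> card (c ` V)"
      using xy(3) finite_V by (metis Nat.le_diff_conv2 One_nat_def Suc_leI card_gt_0_iff empty_iff finite_imageI imageI)
    then have "1 + card (insert e S) + card (d ` V) \<le> card P' + card V"
      using P'(4) card insert.hyps by (simp split: if_splits)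
    moreover have "path_component ?D' p q"
      if zw: "z \<in> V" "w \<in> V" "d z = d w" "p \<in> X z" "q \<in> X w" for z w p q
    proof -
      have "path_component (path_image (A e)) (pathstart (A e)) (pathfinish (A e))"
        using arc_imp_path[OF arc_A[OF e]] unfolding path_component_def by blast
      then have "path_component ?D' (pathstart (A e)) (pathfinish (A e))"
        by (rule path_component_of_subset[rotated]) (auto simp: body_insert)
      then have xy': "path_component ?D' p q" if "p \<in> X x" "q \<in> X y" for p q
        using c[OF xy(3,3) refl that(1) xy(5)] c[OF xy(4,4) refl xy(6) that(2)] sub path_component_trans
        by metis
      consider "c z = c w" | "c z = c x" "c w = c y" | "c z = c y" "c w = c x"
        using zw(3) by (auto simp: d_def split: if_splits)
      then show ?thesis
      proof cases
        case 1
        then show ?thesis using c sub that by blast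
      next
        case 2
        then show ?thesis
          using c[OF that(1) xy(3) _ that(4) xy(5)] c[OF xy(4) that(2) _ xy(6) that(5)]
            xy'[OF xy(5,6)] sub path_component_trans by metis
      next
        case 3
        then show ?thesis
          using c[OF that(1) xy(4) _ that(4) xy(6)] c[OF xy(3) that(2) _ xy(5) that(5)]
            path_component_sym[OF xy'[OF xy(5,6)]] sub path_component_trans by metis
      qed
    qed
    ultimately show ?thesis using P'(1-3) by (intro exI[of _ d] exI[of _ P']) blast
  qed
qed

section \<open>Drawn forests do not separate the plane\<close>

lemma connected_compl_clusters:
  assumes "W \<subseteq> V"
  shows "connected (- body W {})"
  using finite_subset[OF assms finite_V] assms
proof (induction W rule: finite_induct)
  case empty
  show ?case by (simp add: body_def connected_UNIV)
next
  case (insert x W)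
  have "X x \<inter> body W {} = {}"
    using insert disjoint_X[of x] by (auto simp: body_def)
  moreover have "compact (body W {})" using insert by (intro compact_body) auto
  ultimately have "connected (- (X x \<union> body W {}))"
    using insert compact_X connected_compl_X
    by (intro Janiszewski_connected) (auto simp: compact_imp_closed)
  then show ?case by (simp add: body_def)
qed

text \<open>\<open>leaf\<close> says that \<open>M\<close> is a forest: every nonempty set of its
  edges contains one with a free end. A leaf with its edge and the rest of the drawing are two
  non-separating sets that meet in one point, so by Janiszewski's theorem their union does not
  separate either.\<close>

lemma connected_compl_forest:
  assumes "M \<subseteq> E" "W \<subseteq> V" "\<Union>M \<subseteq> W"
    and leaf: "\<And>M'. M' \<subseteq> M \<Longrightarrow> M' \<noteq> {} \<Longrightarrow> \<exists>e\<in>M'. \<exists>x\<in>e. \<forall>f\<in>M'. x \<in> f \<longrightarrow> f = e"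
  shows "connected (- body W M)"
  using finite_subset[OF assms(1) finite_E] assms
proof (induction "card M" arbitrary: M W)
  case 0
  then show ?case using connected_compl_clusters by simp
next
  case (Suc n)
  then have "M \<noteq> {}" by auto
  then obtain e x where ex: "e \<in> M" "x \<in> e" "\<forall>f\<in>M. x \<in> f \<longrightarrow> f = e"
    using Suc.prems(5)[OF subset_refl \<open>M \<noteq> {}\<close>] by (elim bexE)
  have e: "e \<in> E" using ex(1) Suc.prems(2) by blast
  obtain y where y: "e = {x, y}" "x \<noteq> y" "x \<in> V" "y \<in> V" "y \<in> W" "x \<in> W"
  proof -
    obtain a b where ab: "e = {a, b}" "a \<noteq> b" "a \<in> V" "b \<in> V" by (rule edge_ends[OF e])
    have W: "a \<in> W" "b \<in> W" using ab(1) ex(1) Suc.prems(4) by blast+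
    show thesis
    proof (cases "x = a")
      case True
      then show thesis using that[of b] ab W by simp
    next
      case False
      then have "x = b" using ex(2) ab(1) by simp
      then show thesis using that[of a] ab W by (simp add: insert_commute)
    qed
  qed
  let ?Y = "body (W - {x}) (M - {e})" and ?Z = "X x \<union> path_image (A e)"
  have Y: "connected (- ?Y)"
  proof (rule Suc.hyps(1))
    show "n = card (M - {e})" using Suc.hyps(2) ex(1) Suc.prems(1) by simp
    show "\<Union> (M - {e}) \<subseteq> W - {x}" using Suc.prems(4) ex(3) by blast
    show "\<exists>e\<in>M'. \<exists>x\<in>e. \<forall>f\<in>M'. x \<in> f \<longrightarrow> f = e" if "M' \<subseteq> M - {e}" "M' \<noteq> {}" for M'
      using Suc.prems(5)[of M'] that by blast
  qed (use Suc.prems(1-3) in auto)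
  have cA: "compact (path_image (A e))" using arc_A[OF e] by (simp add: compact_arc_image)
  obtain q where q: "path_image (A e) \<inter> X x = {q}" using A_Int_end[OF e ex(2)] by blast
  have Z: "connected (- ?Z)"
    using compact_X[OF y(3)] cA connected_compl_X[OF y(3)] connected_arc_complement[OF arc_A[OF e]] q
    by (intro Janiszewski_connected) (auto simp: compact_imp_closed Int_commute)
  obtain r where r: "path_image (A e) \<inter> X y = {r}" using A_Int_end[OF e, of y] y by blast
  \<comment> \<open>Every other edge misses the leaf \<open>x\<close>, so its arc can meet
    \<open>A e\<close> only inside \<open>X y\<close>.\<close>
  have "?Z \<inter> ?Y = path_image (A e) \<inter> X y"
  proof -
    have "X x \<inter> ?Y = {}"
    proof -
      have "X x \<inter> X z = {}" if "z \<in> W - {x}" for z using that disjoint_X y(3) Suc.prems(3) by blast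
      moreover have "X x \<inter> path_image (A f) = {}" if "f \<in> M - {e}" for f
        using A_Int_other[of f x] that ex(3) y(3) Suc.prems(2) by blast
      ultimately show ?thesis unfolding body_def by blast
    qed
    moreover have "path_image (A e) \<inter> ?Y = path_image (A e) \<inter> X y"
    proof -
      have "path_image (A e) \<inter> X z = {}" if "z \<in> W - {x}" "z \<noteq> y" for z
        using A_Int_other[OF e, of z] that y(1) Suc.prems(3) by blast
      moreover have "path_image (A e) \<inter> path_image (A f) \<subseteq> X y" if "f \<in> M - {e}" for f
      proof -
        have f: "f \<in> E" "e \<noteq> f" using that Suc.prems(2) by auto
        have "x \<notin> f" using ex(3) that by auto
        then have "(\<Union>x\<in>e \<inter> f. X x) \<subseteq> X y" using y(1) by auto
        then show ?thesis using A_Int_A[OF e f] by (rule order_trans[rotated])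
      qed
      moreover have "y \<in> W - {x}" using y(2,5) by blast
      ultimately show ?thesis unfolding body_def by fast
    qed
    ultimately show ?thesis by blast
  qed
  then have "connected (?Z \<inter> ?Y)" using r by simp
  moreover have "compact ?Z" using compact_X[OF y(3)] cA by blast
  moreover have "closed ?Y" using Suc.prems(2,3) by (intro compact_imp_closed compact_body) auto
  ultimately have "connected (- (?Z \<union> ?Y))" using Y Z Janiszewski_connected by blast
  moreover have "?Z \<union> ?Y = body W M" using ex(1) y(6) unfolding body_def by blast
  ultimately show ?case by simp
qed

section \<open>Counting faces against the arcs on their boundaries\<close>

abbreviation "interior_arc e \<equiv> path_image (A e) - {pathstart (A e), pathfinish (A e)}"

abbreviation "face p \<equiv> connected_component_set (- body V E) p"

lemma interior_arc_Int_body: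
  assumes "e \<in> E" "S \<subseteq> E" "e \<notin> S"
  shows "interior_arc e \<inter> body V S = {}"
  using body_Int_A[OF assms] by blast

text \<open>The frontier of a face that borders few edges lies in a drawn forest, which does not separate the
  plane.\<close>
lemma face_boundary_large:
  assumes p: "p \<notin> body V E" and gE: "g \<le> card E"
    and leaf: "\<And>M. M \<subseteq> E \<Longrightarrow> M \<noteq> {} \<Longrightarrow> card M < g \<Longrightarrow> \<exists>e\<in>M. \<exists>x\<in>e. \<forall>f\<in>M. x \<in> f \<longrightarrow> f = e"
  shows "g \<le> card {e\<in>E. closure (face p) \<inter> interior_arc e \<noteq> {}}"
proof (rule ccontr)
  define M where "M = {e\<in>E. closure (face p) \<inter> interior_arc e \<noteq> {}}"
  define f where "f = face p"
  assume "\<not> ?thesis"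
  then have gM: "card M < g" by (simp add: M_def)
  have ME: "M \<subseteq> E" by (auto simp: M_def)
  have "connected (- body V M)"
  proof (rule connected_compl_forest[OF ME subset_refl])
    show "\<Union>M \<subseteq> V" using ME edge_subset by blast
    show "\<exists>e\<in>M'. \<exists>x\<in>e. \<forall>f\<in>M'. x \<in> f \<longrightarrow> f = e" if "M' \<subseteq> M" "M' \<noteq> {}" for M'
    proof (rule leaf)
      show "card M' < g" using gM that card_mono[OF finite_subset[OF ME finite_E] that(1)] by simp
    qed (use that ME in auto)
  qed
  moreover have mono: "body V M \<subseteq> body V E" using ME by (auto simp: body_def)
  moreover have pf: "p \<in> f" using p by (simp add: f_def)
  moreover have fsub: "f \<subseteq> - body V E" unfolding f_def by (rule connected_component_subset)
  \<comment> \<open>The frontier lies in the drawing. An arc outside \<open>M\<close> contributes at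
    most its ends, and these lie in clusters.\<close>
  moreover have "frontier f \<subseteq> body V M"
  proof
    fix q assume q: "q \<in> frontier f"
    have "closed (body V E)" using compact_body[of V E] compact_imp_closed by blast
    then have "frontier f \<subseteq> body V E"
      unfolding f_def
      by (metis frontier_complement frontier_of_connected_component_subset frontier_subset_closed order_trans)
    then have "q \<in> body V E" using q by blast
    moreover have "q \<in> body V M" if "e \<in> E" "q \<in> path_image (A e)" for e
    proof (cases "e \<in> M")
      case True
      then show ?thesis using that by (auto simp: body_def)
    next
      case False
      then have "q \<notin> interior_arc e"
        using q that(1) unfolding M_def frontier_def f_def by blast
      then have "q \<in> (\<Union>x\<in>V. X x)" using that A_Int_clusters[OF that(1)] by blast
      then show ?thesis by (auto simp: body_def)
    qed
    ultimately show "q \<in> body V M" unfolding body_def by blast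
  qed
  \<comment> \<open>A connected set that meets \<open>f\<close> but not its frontier lies in
    \<open>f\<close>. So nothing is drawn outside the forest and \<open>M\<close> is all of
    \<open>E\<close>, against \<open>g \<le> card E\<close>.\<close>
  ultimately have "- body V M \<subseteq> f"
    using connected_Int_frontier[of "- body V M" f] by blast
  then have "body V E \<subseteq> body V M" using fsub by blast
  have "E \<subseteq> M"
  proof (rule ccontr)
    assume "\<not> E \<subseteq> M"
    then obtain e where e: "e \<in> E" "e \<notin> M" by blast
    have "interior_arc e \<subseteq> body V E" using e by (auto simp: body_def)
    then have "interior_arc e = {}"
      using interior_arc_Int_body[OF e(1) ME e(2)] \<open>body V E \<subseteq> body V M\<close> by blast
    then show False using arc_punctured(1)[OF arc_A[OF e(1)]] by blast
  qed
  then have "card E \<le> card M" using finite_subset[OF ME finite_E] by (rule card_mono[rotated])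
  then show False using gM gE by simp
qed

text \<open>With \<open>K\<close> as the drawing from which \<open>e\<close> is erased, three such
  points would contradict the lemma on one arc.\<close>

lemma at_most_two_faces:
  assumes e: "e \<in> E" and P: "finite P" "P \<inter> body V E = {}"
    "pairwise (\<lambda>a b. \<not> connected_component (- body V E) a b) P"
  shows "card {p\<in>P. closure (face p) \<inter> interior_arc e \<noteq> {}} \<le> 2"
proof (rule ccontr)
  let ?Q = "{p\<in>P. closure (face p) \<inter> interior_arc e \<noteq> {}}"
  assume "\<not> ?thesis"
  then have "3 \<le> card ?Q" by simp
  then obtain T where "T \<subseteq> ?Q" "card T = 3" by (meson obtain_subset_with_card_n)
  then obtain a b c where abc: "{a, b, c} \<subseteq> ?Q" "a \<noteq> b" "a \<noteq> c" "b \<noteq> c"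
    by (auto simp: card_3_iff)
  let ?K = "body V (E - {e})"
  have "insert e (E - {e}) = E" using e by auto
  then have D: "body V E = ?K \<union> path_image (A e)" by (metis body_insert)
  show False
  proof (rule arc_meets_at_most_two_faces[OF _ arc_A[OF e] _ D])
    show "compact ?K" by (rule compact_body) auto
    show "?K \<inter> path_image (A e) = {pathstart (A e), pathfinish (A e)}"
      using e by (intro body_Int_A) auto
    show "closure (face d) \<inter> interior_arc e \<noteq> {}" if "d \<in> {a, b, c}" for d
      using that abc(1) by blast
    show "\<not> connected_component (- body V E) a b" "\<not> connected_component (- body V E) a c"
      "\<not> connected_component (- body V E) b c"
      using abc P(3) by (auto simp: pairwise_def)
  qed
qed

text \<open>Here \<open>g\<close> acts as the girth: fewer than \<open>g\<close> edges always form a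
  forest. Every face borders at least \<open>g\<close> arcs and every arc at most two faces, so
  \<open>g * card P \<le> 2 * card E\<close>, while Euler's inequality bounds \<open>card P\<close>
  from below.\<close>

lemma edge_bound:
  assumes "V \<noteq> {}" and gE: "g \<le> card E"
    and leaf: "\<And>M. M \<subseteq> E \<Longrightarrow> M \<noteq> {} \<Longrightarrow> card M < g \<Longrightarrow> \<exists>e\<in>M. \<exists>x\<in>e. \<forall>f\<in>M. x \<in> f \<longrightarrow> f = e"
  shows "g * (card E + 2) \<le> 2 * card E + g * card V"
proof -
  obtain c :: "'a \<Rightarrow> 'a" and P where P: "finite P" "P \<inter> body V E = {}"
    "pairwise (\<lambda>a b. \<not> connected_component (- body V E) a b) P"
    and card: "1 + card E + card (c ` V) \<le> card P + card V"
    using many_faces[OF subset_refl] by blast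
  \<comment> \<open>A nonempty graph keeps at least one label; this is the second unit in the 2 of
    Euler's formula.\<close>
  have "card (c ` V) > 0" using assms(1) finite_V by (simp add: card_gt_0_iff)
  then have "card E + 2 \<le> card P + card V" using card by simp
  then have "g * (card E + 2) \<le> g * card P + g * card V"
    by (metis add_mult_distrib2 mult_le_mono2)
  let ?R = "\<lambda>p e. closure (face p) \<inter> interior_arc e \<noteq> {}"
  have "g * card P = (\<Sum>p\<in>P. g)" by simp
  also have "\<dots> \<le> (\<Sum>p\<in>P. card {e\<in>E. ?R p e})"
    using P(2) by (intro sum_mono face_boundary_large[OF _ gE leaf]) auto
  also have "\<dots> = (\<Sum>e\<in>E. card {p\<in>P. ?R p e})"
    using sum_multicount_gen[of P E ?R "\<lambda>e. card {p\<in>P. ?R p e}"] P(1) finite_E by simp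
  also have "\<dots> \<le> (\<Sum>e\<in>E. 2)"
    using at_most_two_faces[OF _ P] by (intro sum_mono) auto
  also have "\<dots> = 2 * card E" by simp
  finally show ?thesis using \<open>g * (card E + 2) \<le> g * card P + g * card V\<close> by linarith
qed

end

section \<open>Subgraphs and contractions of drawings\<close>

lemma (in cluster_drawing) subgraph:
  assumes "V' \<subseteq> V" "E' \<subseteq> E" "\<Union>E' \<subseteq> V'"
  shows "cluster_drawing V' E' X A"
proof
  show "path_image (A e) \<inter> (\<Union>x\<in>V'. X x) = {pathstart (A e), pathfinish (A e)}" if "e \<in> E'" for e
  proof -
    have e: "e \<in> E" "e \<subseteq> V'" using that assms by auto
    have "path_image (A e) \<inter> (\<Union>x\<in>V'. X x) = path_image (A e) \<inter> (\<Union>x\<in>V. X x)"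
    proof
      show "path_image (A e) \<inter> (\<Union>x\<in>V. X x) \<subseteq> path_image (A e) \<inter> (\<Union>x\<in>V'. X x)"
        using A_Int_other[OF e(1)] e(2) by blast
    qed (use assms(1) in blast)
    then show ?thesis using A_Int_clusters[OF e(1)] by simp
  qed
  show "path_image (A e) \<inter> path_image (A f) \<subseteq> (\<Union>x\<in>e \<inter> f. X x)" if "e \<in> E'" "f \<in> E'" "e \<noteq> f" for e f
    using A_Int_A[of e f] that assms by blast
  show "X x \<inter> X y = {}" if "x \<in> V'" "y \<in> V'" "x \<noteq> y" for x y
    using disjoint_X that assms(1) by blast
  show "path_image (A e) \<inter> X x = {}" if "e \<in> E'" "x \<in> V'" "x \<notin> e" for e x
    using A_Int_other that assms by blast
qed (use assms finite_V in \<open>auto intro: finite_subset compact_X path_connected_X connected_compl_X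
      card_edge arc_A A_Int_end\<close>)

text \<open>The contracted arc and both its clusters become one cluster, which is non-separating by
  Janiszewski's theorem. No arc moves: an edge at \<open>v\<close> only gets a new name with
  \<open>u\<close> for \<open>v\<close>, and if that name is already an edge, the arc of that edge
  is kept.\<close>

lemma (in cluster_drawing) contract:
  assumes uv: "{v, u} \<in> E" and ne: "u \<noteq> v"
  shows "\<exists>X' A'. cluster_drawing (V - {v}) (E \<inter> Pow (V - {v}) \<union> {{u, w} |w. {v, w} \<in> E \<and> w \<noteq> u}) X' A'"
proof -
  define a where "a = path_image (A {v, u})"
  define X' where "X' = X(u := X v \<union> a \<union> X u)"
  \<comment> \<open>The edge of the given graph whose arc represents \<open>e\<close>:
    \<open>e\<close> itself if possible, otherwise the edge that had \<open>v\<close> in place of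
    \<open>u\<close>.\<close>
  define old where "old e = (if e \<in> E then e else insert v (e - {u}))" for e
  define A' where "A' e = A (old e)" for e
  let ?E' = "E \<inter> Pow (V - {v}) \<union> {{u, w} |w. {v, w} \<in> E \<and> w \<noteq> u}"
  have V: "u \<in> V" "v \<in> V" using edge_subset[OF uv] by auto
  have w: "w \<noteq> v \<and> w \<in> V" if "{v, w} \<in> E" for w
    using edge_subset[OF that] card_edge[OF that] by auto
  have ca: "compact a" "path_connected a" "connected (- a)"
    using arc_A[OF uv] unfolding a_def
    by (simp_all add: compact_arc_image connected_arc_complement path_connected_path_image arc_imp_path)
  obtain p where p: "a \<inter> X v = {p}" using A_Int_end[OF uv, of v] unfolding a_def by auto
  obtain q where q: "a \<inter> X u = {q}" using A_Int_end[OF uv, of u] unfolding a_def by auto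
  have vu: "X v \<inter> X u = {}" using disjoint_X V ne by auto
  have e_cases: "(e \<in> E \<and> e \<subseteq> V - {v} \<and> old e = e) \<or>
      (\<exists>w. e = {u, w} \<and> old e = {v, w} \<and> {v, w} \<in> E \<and> w \<noteq> u \<and> w \<noteq> v \<and> w \<in> V)" if e: "e \<in> ?E'" for e
  proof (cases "e \<in> E")
    case True
    then have "v \<notin> e" using e ne w by auto
    then show ?thesis using True edge_subset[OF True] by (auto simp: old_def)
  next
    case False
    then obtain z where z: "e = {u, z}" "{v, z} \<in> E" "z \<noteq> u" using e by auto
    moreover have "old e = {v, z}" using False z by (auto simp: old_def)
    ultimately show ?thesis using w[OF z(2)] by auto
  qed
  have old: "old e \<in> E" if "e \<in> ?E'" for e using e_cases[OF that] by auto
  have old_inj: "old e \<noteq> old f" if "e \<in> ?E'" "f \<in> ?E'" "e \<noteq> f" for e f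
    using e_cases[OF that(1)] e_cases[OF that(2)] that(3) by (auto simp: doubleton_eq_iff)
  have old_ne: "old e \<noteq> {v, u}" if "e \<in> ?E'" for e
    using e_cases[OF that] by (auto simp: doubleton_eq_iff)
  have XX': "X x \<subseteq> X' x" for x by (auto simp: X'_def)
  have Aa: "path_image (A' e) \<inter> a \<subseteq> (\<Union>x\<in>old e \<inter> {v, u}. X x)" if "e \<in> ?E'" for e
    using A_Int_A[OF old[OF that] uv old_ne[OF that]] by (simp add: A'_def a_def)
  \<comment> \<open>Other arcs meet \<open>a\<close> only inside the two clusters that it joins, so
    adding \<open>a\<close> to the new cluster creates no further intersections.\<close>
  have A'u: "path_image (A' e) \<inter> X' u = path_image (A' e) \<inter> (X v \<union> X u)" if "e \<in> ?E'" for e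
    using Aa[OF that] by (auto simp: X'_def)
  have "cluster_drawing (V - {v}) ?E' X' A'"
  proof
    show "finite (V - {v})" using finite_V by simp
    show "compact (X' x)" if "x \<in> V - {v}" for x
      using that V ca compact_X by (auto simp: X'_def)
    show "path_connected (X' x)" if "x \<in> V - {v}" for x
    proof (cases "x = u")
      case True
      have "path_connected (X v \<union> a)" using p ca path_connected_X[OF V(2)]
        by (intro path_connected_Un) auto
      then have "path_connected (X v \<union> a \<union> X u)" using path_connected_X[OF V(1)]
        by (rule path_connected_Un) (use q in blast)
      then show ?thesis using True by (simp add: X'_def)
    qed (use that path_connected_X in \<open>simp add: X'_def\<close>)
    show "connected (- X' x)" if "x \<in> V - {v}" for x
    proof (cases "x = u")
      case True
      have 1: "connected (- (X v \<union> a))"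
        using p ca connected_compl_X[OF V(2)] compact_X[OF V(2)]
        by (intro Janiszewski_connected) (auto simp: compact_imp_closed Int_commute)
      have "(X v \<union> a) \<inter> X u = {q}" using vu q by blast
      then have "connected (- ((X v \<union> a) \<union> X u))"
        using 1 ca(1) connected_compl_X[OF V(1)] compact_X[OF V(1)] compact_X[OF V(2)]
        by (intro Janiszewski_connected[of "X v \<union> a"]) (auto simp: compact_imp_closed)
      then show ?thesis using True by (simp add: X'_def)
    qed (use that connected_compl_X in \<open>simp add: X'_def\<close>)
    have disj: "X' u \<inter> X y = {}" if "y \<in> V" "y \<noteq> u" "y \<noteq> v" for y
      using disjoint_X[OF V(1) that(1)] disjoint_X[OF V(2) that(1)] A_Int_other[OF uv that(1)] that
      by (auto simp: X'_def a_def)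
    show "X' x \<inter> X' y = {}" if xy: "x \<in> V - {v}" "y \<in> V - {v}" "x \<noteq> y" for x y
    proof -
      consider "x = u" "y \<noteq> u" | "x \<noteq> u" "y = u" | "x \<noteq> u" "y \<noteq> u" using xy(3) by blast
      then show ?thesis
      proof cases
        case 1
        then show ?thesis using disj[of y] xy by (simp add: X'_def)
      next
        case 2
        then show ?thesis using disj[of x] xy by (simp add: X'_def Int_commute)
      next
        case 3
        then show ?thesis using disjoint_X xy by (simp add: X'_def)
      qed
    qed
    show "e \<subseteq> V - {v}" if "e \<in> ?E'" for e
      using e_cases[OF that] V ne by auto
    show "card e = 2" if "e \<in> ?E'" for e
      using e_cases[OF that] card_edge[of e] by auto
    show "arc (A' e)" if "e \<in> ?E'" for e
      using arc_A[OF old[OF that]] by (simp add: A'_def)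
    show "path_image (A' e) \<inter> (\<Union>x\<in>V - {v}. X' x) = {pathstart (A' e), pathfinish (A' e)}"
      if "e \<in> ?E'" for e
    proof -
      have "(\<Union>x\<in>V - {v}. X' x) = (\<Union>x\<in>V - {v} - {u}. X x) \<union> X' u"
        using V ne by (auto simp: X'_def)
      then have "path_image (A' e) \<inter> (\<Union>x\<in>V - {v}. X' x)
          = path_image (A' e) \<inter> (\<Union>x\<in>V - {v} - {u}. X x) \<union> path_image (A' e) \<inter> (X v \<union> X u)"
        using A'u[OF that] by (simp add: Int_Un_distrib)
      also have "\<dots> = path_image (A' e) \<inter> (\<Union>x\<in>V. X x)" using V by blast
      finally show ?thesis using A_Int_clusters[OF old[OF that]] by (simp add: A'_def)
    qed
    have A'v: "path_image (A' e) \<inter> X v = {}" if "e \<in> ?E'" "v \<notin> old e" for e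
      using A_Int_other[OF old[OF that(1)] V(2) that(2)] by (simp add: A'_def)
    have A'u0: "path_image (A' e) \<inter> X u = {}" if "e \<in> ?E'" "u \<notin> old e" for e
      using A_Int_other[OF old[OF that(1)] V(1) that(2)] by (simp add: A'_def)
    show "\<exists>q. path_image (A' e) \<inter> X' x = {q}" if e: "e \<in> ?E'" and x: "x \<in> e" for e x
    proof (cases "x = u")
      case False
      then have "x \<in> old e" using e_cases[OF e] x by auto
      then show ?thesis using A_Int_end[OF old[OF e], of x] False by (simp add: A'_def X'_def)
    next
      case True
      show ?thesis
      proof (cases "v \<in> old e")
        \<comment> \<open>A renamed edge had an end at \<open>v\<close> and none at
          \<open>u\<close>, so it enters the merged cluster in one point of
          \<open>X v\<close>.\<close>
        case v: True
        then have "u \<notin> old e" using e_cases[OF e] ne by auto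
        then have "path_image (A' e) \<inter> X' x = path_image (A' e) \<inter> X v"
          using A'u[OF e] A'u0[OF e] True by (simp add: Int_Un_distrib)
        then show ?thesis using A_Int_end[OF old[OF e] v] by (simp add: A'_def)
      next
        case v: False
        then have "old e = e" using e_cases[OF e] by auto
        then have "u \<in> old e" using True x by simp
        moreover have "path_image (A' e) \<inter> X' x = path_image (A' e) \<inter> X u"
          using A'u[OF e] A'v[OF e v] True by (simp add: Int_Un_distrib)
        ultimately show ?thesis using A_Int_end[OF old[OF e]] by (simp add: A'_def)
      qed
    qed
    show "path_image (A' e) \<inter> X' x = {}" if e: "e \<in> ?E'" and x: "x \<in> V - {v}" "x \<notin> e" for e x
    proof (cases "x = u")
      case False
      then have "x \<notin> old e" using e_cases[OF e] x by auto
      then show ?thesis using A_Int_other[OF old[OF e], of x] False x by (simp add: A'_def X'_def)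
    next
      case True
      then have "u \<notin> old e" "v \<notin> old e" using e_cases[OF e] x by auto
      then show ?thesis using A'u[OF e] A'v[OF e] A'u0[OF e] True by (simp add: Int_Un_distrib)
    qed
    show "path_image (A' e) \<inter> path_image (A' f) \<subseteq> (\<Union>x\<in>e \<inter> f. X' x)"
      if e: "e \<in> ?E'" and f: "f \<in> ?E'" and "e \<noteq> f" for e f
    proof -
      have "path_image (A' e) \<inter> path_image (A' f) \<subseteq> (\<Union>x\<in>old e \<inter> old f. X x)"
        using A_Int_A[OF old[OF e] old[OF f] old_inj[OF that]] by (simp add: A'_def)
      also have "\<dots> \<subseteq> (\<Union>x\<in>e \<inter> f. X' x)"
      proof (rule UN_least)
        fix x assume x: "x \<in> old e \<inter> old f"
        show "X x \<subseteq> (\<Union>x\<in>e \<inter> f. X' x)"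
        proof (cases "x = v")
          case True
          then have "u \<in> e \<inter> f" using e_cases[OF e] e_cases[OF f] x by auto
          moreover have "X v \<subseteq> X' u" by (auto simp: X'_def)
          ultimately show ?thesis using True by blast
        next
          case False
          then have "x \<in> e \<inter> f" using e_cases[OF e] e_cases[OF f] x by auto
          then show ?thesis using XX' by blast
        qed
      qed
      finally show ?thesis .
    qed
  qed
  then show ?thesis by blast
qed

lemma planar_cluster_drawing:
  assumes "simple_graph V E" "plane_drawing V E p \<gamma>"
  shows "cluster_drawing V E (\<lambda>x. {p x}) \<gamma>"
proof
  have G: "finite V" "\<And>e. e \<in> E \<Longrightarrow> e \<subseteq> V \<and> card e = 2" using assms(1) by (auto simp: simple_graph_def)
  have inj: "inj_on p V"
    and arc: "\<And>e. e \<in> E \<Longrightarrow> arc (\<gamma> e) \<and> {pathstart (\<gamma> e), pathfinish (\<gamma> e)} = p ` e \<and>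
             path_image (\<gamma> e) \<inter> p ` V = p ` e"
    and Int: "\<And>e f. e \<in> E \<Longrightarrow> f \<in> E \<Longrightarrow> e \<noteq> f \<Longrightarrow> path_image (\<gamma> e) \<inter> path_image (\<gamma> f) = p ` (e \<inter> f)"
    using assms(2) by (auto simp: plane_drawing_def)
  show "finite V" "\<And>e. e \<in> E \<Longrightarrow> e \<subseteq> V" "\<And>e. e \<in> E \<Longrightarrow> card e = 2" "\<And>e. e \<in> E \<Longrightarrow> arc (\<gamma> e)"
    using G arc by auto
  show "connected (- {p x})" for x
    using connected_open_delete_finite[of "UNIV :: complex set" "{p x}"] connected_UNIV
    by (simp add: Compl_eq_Diff_UNIV)
  show "{p x} \<inter> {p y} = {}" if "x \<in> V" "y \<in> V" "x \<noteq> y" for x y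
    using inj that by (auto simp: inj_on_def)
  show "path_image (\<gamma> e) \<inter> (\<Union>x\<in>V. {p x}) = {pathstart (\<gamma> e), pathfinish (\<gamma> e)}" if "e \<in> E" for e
  proof -
    have "(\<Union>x\<in>V. {p x}) = p ` V" by auto
    then show ?thesis using arc[OF that] by simp
  qed
  show "\<exists>q. path_image (\<gamma> e) \<inter> {p x} = {q}" if "e \<in> E" "x \<in> e" for e x
  proof -
    have "p x \<in> path_image (\<gamma> e)" using arc[OF that(1)] that(2) by blast
    then show ?thesis by auto
  qed
  show "path_image (\<gamma> e) \<inter> {p x} = {}" if "e \<in> E" "x \<in> V" "x \<notin> e" for e x
  proof -
    have "p x \<notin> p ` e" using inj that G(2)[OF that(1)] by (auto simp: inj_on_def)
    then show ?thesis using arc[OF that(1)] that(2) by blast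
  qed
  show "path_image (\<gamma> e) \<inter> path_image (\<gamma> f) \<subseteq> (\<Union>x\<in>e \<inter> f. {p x})" if "e \<in> E" "f \<in> E" "e \<noteq> f" for e f
    using Int[OF that] by auto
qed auto

section \<open>Edge counts for simple and for bipartite plane graphs\<close>

context cluster_drawing
begin

text \<open>The edge bound with \<open>g = 3\<close>: one or two edges always leave a free end. For
  fewer than three edges a single vertex suffices.\<close>

lemma edge_count: "V \<noteq> {} \<Longrightarrow> card E < 3 * card V"
proof (cases "3 \<le> card E")
  case True
  assume V: "V \<noteq> {}"
  have "3 * (card E + 2) \<le> 2 * card E + 3 * card V"
  proof (rule edge_bound[OF V True])
    fix M assume M: "M \<subseteq> E" "M \<noteq> {}" "card M < 3"
    have fM: "finite M" using M(1) finite_E finite_subset by blast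
    obtain e where e: "e \<in> M" using M(2) by blast
    have e2: "card e = 2" using e M(1) card_edge by blast
    show "\<exists>e\<in>M. \<exists>x\<in>e. \<forall>f\<in>M. x \<in> f \<longrightarrow> f = e"
    proof (cases "M = {e}")
      case True
      then show ?thesis using e2 by (auto simp: card_2_iff)
    next
      case False
      then obtain f where f: "f \<in> M" "f \<noteq> e" using e by blast
      then have "card M = card {e, f}" using M(3) e card_mono[OF fM, of "{e, f}"] by auto
      then have "M = {e, f}" using e f fM card_subset_eq[of M "{e, f}"] by auto
      moreover have "card f = 2" using f M(1) card_edge by blast
      moreover obtain x where "x \<in> e" "x \<notin> f"
        using f(2) e2 \<open>card f = 2\<close> by (auto simp: card_2_iff)
      ultimately show ?thesis by blast
    qed
  qed
  then show ?thesis by simp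
next
  case False
  assume "V \<noteq> {}"
  then have "card V > 0" using finite_V by (simp add: card_gt_0_iff)
  then show ?thesis using False by linarith
qed

text \<open>The edge bound with \<open>g = 4\<close>. Three edges without a free end would form a
  path with some edge \<open>{s, b}\<close> in the middle, but then its outer end \<open>b'\<close>
  is free.\<close>

lemma bipartite_edge_count:
  assumes bip: "\<And>e. e \<in> E \<Longrightarrow> \<exists>s\<in>S. \<exists>b\<in>B. e = {s, b}" and SB: "S \<inter> B = {}"
  shows "card E \<le> 2 * card V"
proof (cases "4 \<le> card E")
  case True
  then have V: "V \<noteq> {}" using edge_subset card_edge
    by (metis bot.extremum_uniqueI card.empty equals0I not_numeral_le_zero zero_neq_numeral)
  have "4 * (card E + 2) \<le> 2 * card E + 4 * card V"
  proof (rule edge_bound[OF V True], rule ccontr)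
    fix M assume M: "M \<subseteq> E" "M \<noteq> {}" "card M < 4"
      and "\<not> (\<exists>e\<in>M. \<exists>x\<in>e. \<forall>f\<in>M. x \<in> f \<longrightarrow> f = e)"
    then have other: "\<exists>f\<in>M. x \<in> f \<and> f \<noteq> e" if "e \<in> M" "x \<in> e" for e x using that by blast
    have fM: "finite M" using M(1) finite_E finite_subset by blast
    have bipM: "\<exists>s\<in>S. \<exists>b\<in>B. e = {s, b}" if "e \<in> M" for e using that M(1) bip by blast
    obtain e where e: "e \<in> M" using M(2) by blast
    obtain s b where sb: "s \<in> S" "b \<in> B" "e = {s, b}" using bipM[OF e] by blast
    obtain f where f: "f \<in> M" "s \<in> f" "f \<noteq> e" using other[OF e, of s] sb by blast
    obtain b' where b': "b' \<in> B" "f = {s, b'}" using bipM[OF f(1)] f(2) sb(1) SB by blast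
    obtain g where g: "g \<in> M" "b \<in> g" "g \<noteq> e" using other[OF e, of b] sb by blast
    obtain s' where s': "s' \<in> S" "g = {s', b}" using bipM[OF g(1)] g(2) sb(2) SB by blast
    have ne: "b' \<noteq> b" "s' \<noteq> s" using f(3) g(3) sb(3) b' s' by auto
    have "f \<noteq> g" using ne SB sb b' s' by (auto simp: doubleton_eq_iff)
    then have "card {e, f, g} = 3" using f(3) g(3) by auto
    then have "card M = card {e, f, g}" using M(3) e f(1) g(1) card_mono[OF fM, of "{e, f, g}"] by auto
    then have "M = {e, f, g}" using e f g fM card_subset_eq[of M "{e, f, g}"] by auto
    moreover have "b' \<notin> e" "b' \<notin> g" using ne SB sb b' s' by auto
    ultimately show False using other[OF f(1), of b'] b' by blast
  qed
  then show ?thesis by simp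
next
  case False
  show ?thesis
  proof (cases "E = {}")
    case False
    then obtain e where "e \<in> E" by blast
    \<comment> \<open>Two vertices already allow the at most three edges of this case.\<close>
    then have "2 \<le> card V" using edge_subset card_edge card_mono[OF finite_V] by metis
    then show ?thesis using \<open>\<not> 4 \<le> card E\<close> by linarith
  qed simp
qed

end

subsection \<open>Reducible vertices\<close>

definition large_neighbours :: "'a set set \<Rightarrow> nat \<Rightarrow> 'a \<Rightarrow> nat" where
  "large_neighbours E t v = card {u \<in> neighbourhood E v. t \<le> vertex_degree E u}"

lemma neighbourhood_sym: "u \<in> neighbourhood E v \<longleftrightarrow> v \<in> neighbourhood E u"
  by (simp add: neighbourhood_def insert_commute)

lemma neighbourhood_subset:
  assumes "simple_graph V E"
  shows "neighbourhood E v \<subseteq> V - {v}"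
proof
  fix u assume "u \<in> neighbourhood E v"
  then have "{v, u} \<subseteq> V \<and> card {v, u} = 2"
    using assms by (auto simp: neighbourhood_def simple_graph_def)
  then show "u \<in> V - {v}" by (cases "u = v") auto
qed

lemma finite_neighbourhood: "simple_graph V E \<Longrightarrow> finite (neighbourhood E v)"
  using neighbourhood_subset by (metis finite_Diff finite_subset simple_graph_def)

lemma sum_card_neighbours:
  assumes G: "simple_graph V E" and "S \<subseteq> V" "S \<inter> B = {}"
  shows "(\<Sum>s\<in>S. card (neighbourhood E s \<inter> B)) = card {e\<in>E. \<exists>s\<in>S. \<exists>b\<in>B. e = {s, b}}"
proof -
  have fS: "finite S" using G assms(2) by (auto simp: simple_graph_def intro: finite_subset)
  have "(\<Sum>s\<in>S. card (neighbourhood E s \<inter> B)) = card (SIGMA s:S. neighbourhood E s \<inter> B)"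
    using fS finite_neighbourhood[OF G] by simp
  also have "\<dots> = card ((\<lambda>(s, b). {s, b}) ` (SIGMA s:S. neighbourhood E s \<inter> B))"
    using assms(3) by (intro card_image[symmetric]) (auto simp: inj_on_def doubleton_eq_iff)
  also have "(\<lambda>(s, b). {s, b}) ` (SIGMA s:S. neighbourhood E s \<inter> B) = {e\<in>E. \<exists>s\<in>S. \<exists>b\<in>B. e = {s, b}}"
    by (auto simp: neighbourhood_def)
  finally show ?thesis .
qed

lemma handshake:
  assumes G: "simple_graph V E"
  shows "(\<Sum>v\<in>V. vertex_degree E v) = 2 * card E"
proof -
  have fV: "finite V" and E: "\<And>e. e \<in> E \<Longrightarrow> e \<subseteq> V \<and> card e = 2"
    using G by (auto simp: simple_graph_def)
  then have fE: "finite E" by (meson PowI finite_Pow_iff finite_subset subsetI)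
  have "vertex_degree E v = card {e\<in>E. v \<in> e}" for v
  proof -
    have "{e\<in>E. v \<in> e} = (\<lambda>u. {v, u}) ` neighbourhood E v"
    proof (intro equalityI subsetI)
      fix e assume "e \<in> {e\<in>E. v \<in> e}"
      then obtain u where "e = {v, u}" using E by (metis (no_types, lifting) card_2_iff insert_commute insert_iff mem_Collect_eq singletonD)
      then show "e \<in> (\<lambda>u. {v, u}) ` neighbourhood E v"
        using \<open>e \<in> {e\<in>E. v \<in> e}\<close> by (auto simp: neighbourhood_def)
    qed (auto simp: neighbourhood_def)
    moreover have "inj_on (\<lambda>u. {v, u}) (neighbourhood E v)"
      by (auto simp: inj_on_def doubleton_eq_iff)
    ultimately show ?thesis by (simp add: vertex_degree_def card_image)
  qed
  then have "(\<Sum>v\<in>V. vertex_degree E v) = (\<Sum>v\<in>V. card {e\<in>E. v \<in> e})" by simp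
  also have "\<dots> = 2 * card E"
  proof (rule sum_multicount[OF fV fE], rule ballI)
    fix e assume "e \<in> E"
    then have "{v\<in>V. v \<in> e} = e" using E by blast
    then show "card {v\<in>V. v \<in> e} = 2" using E \<open>e \<in> E\<close> by simp
  qed
  finally show ?thesis .
qed

text \<open>The right-hand side sums over the neighbours a step function of the degree with jumps at
  7, 8 and 12. Its values 5, 6, 10 and \<open>C - 1\<close> are the largest possible values of the
  degree minus one on the four ranges.\<close>

lemma sum_degrees_neighbours_bound:
  fixes C :: nat
  assumes G: "simple_graph V E" and deg: "\<And>u. u \<in> V \<Longrightarrow> vertex_degree E u \<le> C" and C: "12 \<le> C"
  shows "(\<Sum>u\<in>neighbourhood E v. vertex_degree E u - 1)
    \<le> 5 * vertex_degree E v + large_neighbours E 7 v + 4 * large_neighbours E 8 v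
      + (C - 11) * large_neighbours E 12 v"
proof -
  let ?N = "neighbourhood E v" and ?d = "vertex_degree E"
  have fN: "finite ?N" by (rule finite_neighbourhood[OF G])
  have ind: "large_neighbours E t v = (\<Sum>u\<in>?N. if t \<le> ?d u then 1 else 0)" for t
    using fN by (simp add: large_neighbours_def sum.If_cases Int_def)
  have "(\<Sum>u\<in>?N. ?d u - 1) \<le> (\<Sum>u\<in>?N. 5 + (if 7 \<le> ?d u then 1 else 0) + 4 * (if 8 \<le> ?d u then 1 else 0)
      + (C - 11) * (if 12 \<le> ?d u then 1 else 0))"
  proof (rule sum_mono)
    fix u assume "u \<in> ?N"
    then have "?d u \<le> C" using neighbourhood_subset[OF G] deg by blast
    then show "?d u - 1 \<le> 5 + (if 7 \<le> ?d u then 1 else 0) + 4 * (if 8 \<le> ?d u then 1 else 0)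
      + (C - 11) * (if 12 \<le> ?d u then 1 else 0)" using C by auto
  qed
  also have "\<dots> = 5 * ?d v + large_neighbours E 7 v + 4 * large_neighbours E 8 v
      + (C - 11) * large_neighbours E 12 v"
    unfolding ind by (simp only: sum.distrib sum_distrib_left) (simp add: vertex_degree_def)
  finally show ?thesis .
qed

lemma small_neighbour:
  assumes "simple_graph V E" "large_neighbours E t v < vertex_degree E v"
  shows "\<exists>u\<in>neighbourhood E v. vertex_degree E u < t"
proof (rule ccontr)
  assume "\<not> ?thesis"
  then have "{u \<in> neighbourhood E v. t \<le> vertex_degree E u} = neighbourhood E v" by auto
  then show False using assms(2) by (simp add: large_neighbours_def vertex_degree_def)
qed

lemma large_neighbours_antimono:
  assumes "simple_graph V E" "s \<le> t"
  shows "large_neighbours E t v \<le> large_neighbours E s v"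
  unfolding large_neighbours_def using finite_neighbourhood[OF assms(1)] assms(2)
  by (intro card_mono) auto

lemma large_neighbours_le_degree:
  assumes "simple_graph V E"
  shows "large_neighbours E t v \<le> vertex_degree E v"
  unfolding large_neighbours_def vertex_degree_def using finite_neighbourhood[OF assms]
  by (intro card_mono) auto

text \<open>By contraposition: a low weight means few neighbours of large degree, which bounds the
  degree sum and leaves a neighbour small enough for the contraction. Truncated subtraction counts
  only the large neighbours beyond two.\<close>

lemma irreducible_small_vertex:
  assumes G: "simple_graph V E" and deg: "\<And>u. u \<in> V \<Longrightarrow> vertex_degree E u \<le> C" and C: "12 \<le> C"
    and small: "vertex_degree E v \<le> 5"
    and irr: "\<not> ((\<Sum>u\<in>neighbourhood E v. vertex_degree E u - 1) \<le> 2 * C + 19 \<and>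
        (neighbourhood E v = {} \<or> (\<exists>u\<in>neighbourhood E v. vertex_degree E u + vertex_degree E v \<le> C + 2)))"
  shows "2 * (6 - vertex_degree E v) \<le> 4 * (large_neighbours E 12 v - 2)
      + (large_neighbours E 8 v - 2) + (large_neighbours E 7 v - 2)"
proof (rule ccontr)
  define m a b c where "m = vertex_degree E v" and "a = large_neighbours E 12 v"
    and "b = large_neighbours E 8 v" and "c = large_neighbours E 7 v"
  note defs = this
  assume "\<not> ?thesis"
  then have less: "4 * (a - 2) + (b - 2) + (c - 2) < 2 * (6 - m)" by (simp add: defs)
  have le: "a \<le> b" "b \<le> c" "c \<le> m" "m \<le> 5"
    unfolding defs using large_neighbours_antimono[OF G] large_neighbours_le_degree[OF G] small by auto
  have u_le: "vertex_degree E u \<le> C" if "u \<in> neighbourhood E v" for u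
    using that deg neighbourhood_subset[OF G] by blast
  have abc: "a \<le> 2" "b \<le> 3" "c \<le> 4" using less le by linarith+
  have "(C - 11) * a \<le> (C - 11) * 2" using abc(1) by simp
  \<comment> \<open>The constant is \<open>5 * 5 + 4 + 4 * 3 - 2 * 11 = 19\<close>.\<close>
  then have "5 * m + c + 4 * b + (C - 11) * a \<le> 2 * C + 19"
    using abc le(4) C by linarith
  then have sum: "(\<Sum>u\<in>neighbourhood E v. vertex_degree E u - 1) \<le> 2 * C + 19"
    using sum_degrees_neighbours_bound[OF G deg C, of v] unfolding defs by linarith
  have no: "neighbourhood E v \<noteq> {}" "\<And>u. u \<in> neighbourhood E v \<Longrightarrow> C + 2 < vertex_degree E u + m"
    using irr sum by (force simp: m_def)+
  have "m \<ge> 3"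
  proof (rule ccontr)
    assume "\<not> m \<ge> 3"
    obtain u where "u \<in> neighbourhood E v" using no(1) by blast
    then show False using no(2)[of u] u_le[of u] \<open>\<not> m \<ge> 3\<close> by linarith
  qed
  \<comment> \<open>For \<open>m\<close> equal to 3, 4 or 5 some neighbour has degree at most 11, 7
    or 6. Together with \<open>m\<close> this is at most 14, hence within
    \<open>C + 2\<close>.\<close>
  then consider "m = 3" "a < m" | "m = 4" "b < m" | "m = 5" "c < m" using le abc less by linarith
  then show False
  proof cases
    case 1
    then obtain u where "u \<in> neighbourhood E v" "vertex_degree E u < 12"
      using small_neighbour[OF G] unfolding defs by blast
    then show False using no(2)[of u] 1 C by linarith
  next
    case 2
    then obtain u where "u \<in> neighbourhood E v" "vertex_degree E u < 8"
      using small_neighbour[OF G] unfolding defs by blast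
    then show False using no(2)[of u] 2 C by linarith
  next
    case 3
    then obtain u where "u \<in> neighbourhood E v" "vertex_degree E u < 7"
      using small_neighbour[OF G] unfolding defs by blast
    then show False using no(2)[of u] 3 C by linarith
  qed
qed

section \<open>Existence of a reducible vertex by discharging\<close>

context cluster_drawing
begin

lemma simple_graph: "simple_graph V E"
  using finite_V edge_subset card_edge by (auto simp: simple_graph_def)

text \<open>The bipartite count allows two edges per vertex of \<open>S\<close> and
  \<open>B\<close>: the share of \<open>S\<close> is the subtracted 2, the share of \<open>B\<close>
  is the bound. The condition \<open>6 \<le> t\<close> keeps the two sides disjoint.\<close>

lemma sum_large_neighbours_bound:
  assumes t: "6 \<le> t"
  shows "(\<Sum>v\<in>{v\<in>V. vertex_degree E v \<le> 5}. large_neighbours E t v - 2)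
    \<le> 2 * card {v\<in>V. t \<le> vertex_degree E v}"
proof -
  define B where "B = {v\<in>V. t \<le> vertex_degree E v}"
  \<comment> \<open>Vertices with at most two large neighbours contribute 0 to the truncated sum;
    without them the subtraction is exact.\<close>
  define S where "S = {v\<in>V. vertex_degree E v \<le> 5 \<and> 2 < large_neighbours E t v}"
  have sub: "S \<subseteq> V" "B \<subseteq> V" "S \<inter> B = {}" using t by (auto simp: S_def B_def)
  have fin: "finite S" "finite B" using sub(1,2) by (auto intro: finite_subset[OF _ finite_V])
  have large: "large_neighbours E t v = card (neighbourhood E v \<inter> B)" for v
    unfolding large_neighbours_def B_def using neighbourhood_subset[OF simple_graph, of v]
    by (intro arg_cong[of _ _ card]) auto
  let ?E = "{e\<in>E. \<exists>s\<in>S. \<exists>b\<in>B. e = {s, b}}"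
  interpret sub: cluster_drawing "S \<union> B" ?E X A
    by (rule subgraph) (use sub in auto)
  have "(\<Sum>v\<in>S. large_neighbours E t v - 2) + 2 * card S = (\<Sum>v\<in>S. (large_neighbours E t v - 2) + 2)"
    by (simp only: sum.distrib) simp
  also have "\<dots> = (\<Sum>v\<in>S. card (neighbourhood E v \<inter> B))"
    by (intro sum.cong) (auto simp: S_def large[symmetric])
  also have "\<dots> = card ?E"
    by (rule sum_card_neighbours[OF simple_graph sub(1,3)])
  also have "\<dots> \<le> 2 * card (S \<union> B)"
    by (rule sub.bipartite_edge_count[of S B]) (use sub in auto)
  also have "\<dots> = 2 * card S + 2 * card B"
    using fin sub(3) by (simp add: card_Un_disjoint)
  finally have "(\<Sum>v\<in>S. large_neighbours E t v - 2) \<le> 2 * card B" by simp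
  moreover have "(\<Sum>v\<in>{v\<in>V. vertex_degree E v \<le> 5}. large_neighbours E t v - 2)
      = (\<Sum>v\<in>S. large_neighbours E t v - 2)"
    using finite_V by (intro sum.mono_neutral_right) (auto simp: S_def)
  ultimately show ?thesis by (simp add: B_def)
qed

text \<open>Otherwise every vertex would reach 12 with twice its degree, increased by
  \<open>w\<close> at the small vertices, even after the large vertices have paid for all of
  \<open>w\<close>. That contradicts having fewer than \<open>3 * card V\<close> edges.\<close>

lemma reducible_vertex:
  assumes "V \<noteq> {}" and C: "12 \<le> C" and deg: "\<And>u. u \<in> V \<Longrightarrow> vertex_degree E u \<le> C"
  shows "\<exists>v\<in>V. vertex_degree E v \<le> 5 \<and>
    (\<Sum>u\<in>neighbourhood E v. vertex_degree E u - 1) \<le> 2 * C + 19 \<and>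
    (neighbourhood E v = {} \<or> (\<exists>u\<in>neighbourhood E v. vertex_degree E u + vertex_degree E v \<le> C + 2))"
proof (rule ccontr)
  assume irr: "\<not> ?thesis"
  define d where "d = vertex_degree E"
  define S where "S = {v\<in>V. d v \<le> 5}"
  define w where "w v = 4 * (large_neighbours E 12 v - 2)
      + (large_neighbours E 8 v - 2) + (large_neighbours E 7 v - 2)" for v
  have Sw: "2 * (6 - d v) \<le> w v" if "v \<in> S" for v
    unfolding w_def d_def using irreducible_small_vertex[OF simple_graph deg C, of v]
      irr that by (auto simp: S_def d_def)
  define B where "B t = {v\<in>V. t \<le> d v}" for t
  have ind: "card (B t) = (\<Sum>v\<in>V. if t \<le> d v then 1 else 0)" for t
    using finite_V by (simp add: B_def sum.If_cases Int_def)
  have "12 * card V = (\<Sum>v\<in>V. 12)" by simp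
  also have "\<dots> + 8 * card (B 12) + 2 * card (B 8) + 2 * card (B 7)
      = (\<Sum>v\<in>V. 12 + 8 * (if 12 \<le> d v then 1 else 0) + 2 * (if 8 \<le> d v then 1 else 0)
        + 2 * (if 7 \<le> d v then 1 else 0))"
    unfolding ind by (simp only: sum.distrib sum_distrib_left)
  \<comment> \<open>This holds vertex by vertex: degrees 6, 7, 8 and 12 give equality, and for
    degree at most 5 the weight \<open>w\<close> makes up the deficit.\<close>
  also have "\<dots> \<le> (\<Sum>v\<in>V. 2 * d v + (if v \<in> S then w v else 0))"
  proof (rule sum_mono)
    fix v assume "v \<in> V"
    then show "12 + 8 * (if 12 \<le> d v then 1 else 0) + 2 * (if 8 \<le> d v then 1 else 0)
        + 2 * (if 7 \<le> d v then 1 else 0) \<le> 2 * d v + (if v \<in> S then w v else 0)"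
      using Sw[of v] by (cases "v \<in> S") (auto simp: S_def)
  qed
  also have "\<dots> = 2 * (\<Sum>v\<in>V. d v) + (\<Sum>v\<in>S. w v)"
    using finite_V by (simp add: sum.distrib sum_distrib_left sum.If_cases S_def Int_def)
  also have "(\<Sum>v\<in>V. d v) = 2 * card E"
    unfolding d_def by (rule handshake[OF simple_graph])
  also have "(\<Sum>v\<in>S. w v) \<le> 8 * card (B 12) + 2 * card (B 8) + 2 * card (B 7)"
    unfolding w_def using sum_large_neighbours_bound[of 12] sum_large_neighbours_bound[of 8]
      sum_large_neighbours_bound[of 7]
    by (simp add: sum.distrib sum_distrib_left[symmetric] S_def B_def d_def)
  finally have "12 * card V \<le> 2 * (2 * card E)" by simp
  then show False using edge_count[OF assms(1)] by simp
qed

end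

subsection \<open>Colouring\<close>

text \<open>The star at \<open>u\<close> in \<open>E'\<close> ensures that no colour occurs more than \<open>k\<close> times around \<open>v\<close>.\<close>
lemma extend_colouring:
  fixes c :: "'a \<Rightarrow> 'c" and k :: nat
  assumes G: "simple_graph V E" and k: "1 \<le> k" and v: "v \<in> V"
    and G': "simple_graph (V - {v}) E'" and sub: "E \<inter> Pow (V - {v}) \<subseteq> E'"
    and star: "neighbourhood E v = {} \<or>
      (\<exists>u\<in>neighbourhood E v. \<forall>w\<in>neighbourhood E v. w \<noteq> u \<longrightarrow> {u, w} \<in> E')"
    and c: "frugal_colouring k (V - {v}) E' c"
    and L: "vertex_degree E v + (\<Sum>u\<in>neighbourhood E v. vertex_degree E u - 1) div k < card L"
  shows "\<exists>x\<in>L. frugal_colouring k V E (c(v := x))"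
proof -
  let ?N = "neighbourhood E"
  have fin: "finite (?N z)" and finE': "finite (neighbourhood E' z)" for z
    by (rule finite_neighbourhood[OF G], rule finite_neighbourhood[OF G'])
  have NV: "?N z \<subseteq> V - {z}" for z by (rule neighbourhood_subset[OF G])
  have old: "{y, z} \<in> E'" if "{y, z} \<in> E" "y \<noteq> v" "z \<noteq> v" for y z
  proof -
    have "{y, z} \<subseteq> V" using that(1) G by (auto simp: simple_graph_def)
    then show ?thesis using that sub by blast
  qed
  \<comment> \<open>The colours that \<open>v\<close> must not bring to \<open>w\<close>, since they
    already occur \<open>k\<close> times there.\<close>
  define F where "F w = {x. k \<le> card {y \<in> ?N w - {v}. c y = x}}" for w
  have FF: "F w \<subseteq> c ` (?N w - {v})" for w
  proof
    fix x assume "x \<in> F w"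
    then have "card {y \<in> ?N w - {v}. c y = x} \<noteq> 0" using k by (simp add: F_def)
    then have "{y \<in> ?N w - {v}. c y = x} \<noteq> {}" by (metis card.empty)
    then show "x \<in> c ` (?N w - {v})" by blast
  qed
  then have finF: "finite (F w)" for w using fin finite_subset by (metis finite_Diff finite_imageI)
  \<comment> \<open>The colours in \<open>F w\<close> have disjoint classes of at least
    \<open>k\<close> vertices among the neighbours of \<open>w\<close> other than
    \<open>v\<close>.\<close>
  have kF: "k * card (F w) \<le> vertex_degree E w - 1" if "w \<in> ?N v" for w
  proof -
    have "k * card (F w) = (\<Sum>x\<in>F w. k)" by simp
    also have "\<dots> \<le> (\<Sum>x\<in>F w. card {y \<in> ?N w - {v}. c y = x})"
      by (intro sum_mono) (simp add: F_def)
    also have "\<dots> = card (\<Union>x\<in>F w. {y \<in> ?N w - {v}. c y = x})"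
      using finF fin by (intro card_UN_disjoint[symmetric]) auto
    also have "\<dots> \<le> card (?N w - {v})" using fin by (intro card_mono) auto
    also have "\<dots> = vertex_degree E w - 1"
      using that neighbourhood_sym[of w E v] by (simp add: vertex_degree_def)
    finally show ?thesis .
  qed
  have "k * card (\<Union>w\<in>?N v. F w) \<le> k * (\<Sum>w\<in>?N v. card (F w))"
    using fin by (intro mult_le_mono2 card_UN_le)
  also have "\<dots> \<le> (\<Sum>w\<in>?N v. vertex_degree E w - 1)"
    unfolding sum_distrib_left by (intro sum_mono kF)
  finally have "card (\<Union>w\<in>?N v. F w) \<le> (\<Sum>u\<in>?N v. vertex_degree E u - 1) div k"
    using k by (simp add: less_eq_div_iff_mult_less_eq mult.commute)
  moreover have "card (c ` ?N v) \<le> vertex_degree E v"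
    unfolding vertex_degree_def by (rule card_image_le[OF fin])
  ultimately have "card (c ` ?N v \<union> (\<Union>w\<in>?N v. F w)) < card L"
    using L card_Un_le[of "c ` ?N v" "\<Union>w\<in>?N v. F w"] by linarith
  moreover have "finite (c ` ?N v \<union> (\<Union>w\<in>?N v. F w))" using fin finF by auto
  ultimately have "\<not> L \<subseteq> c ` ?N v \<union> (\<Union>w\<in>?N v. F w)" using card_mono leD by blast
  then obtain x where x: "x \<in> L" "x \<notin> c ` ?N v" "\<And>w. w \<in> ?N v \<Longrightarrow> x \<notin> F w" by blast
  have proper: "c y \<noteq> c z" if "{y, z} \<in> E'" for y z
    using c that by (auto simp: frugal_colouring_def proper_colouring_def)
  have frugal: "card {y \<in> neighbourhood E' z. c y = q} \<le> k" if "z \<in> V - {v}" for z q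
    using c that by (auto simp: frugal_colouring_def)
  have "proper_colouring E (c(v := x))"
    unfolding proper_colouring_def
  proof (intro allI impI)
    fix y z assume yz: "{y, z} \<in> E"
    then have "y \<noteq> z" using G by (auto simp: simple_graph_def)
    then consider "y = v" "z \<noteq> v" "z \<in> ?N v" | "z = v" "y \<noteq> v" "y \<in> ?N v" | "y \<noteq> v" "z \<noteq> v"
      using yz neighbourhood_sym[of y E z] by (auto simp: neighbourhood_def)
    then show "(c(v := x)) y \<noteq> (c(v := x)) z"
      using x(2) proper[OF old[OF yz]] by cases auto
  qed
  moreover have "card {y \<in> ?N z. (c(v := x)) y = q} \<le> k" if z: "z \<in> V" for z q
  proof (cases "z = v")
    case True
    have eq: "{y \<in> ?N z. (c(v := x)) y = q} = {y \<in> ?N v. c y = q}" using NV[of v] True by auto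
    show ?thesis
    proof (cases "?N v = {}")
      case False
      then obtain u where u: "u \<in> ?N v" "\<And>w. w \<in> ?N v \<Longrightarrow> w \<noteq> u \<Longrightarrow> {u, w} \<in> E'"
        using star by blast
      \<comment> \<open>The other neighbours of \<open>v\<close> are adjacent to \<open>u\<close> in
        \<open>E'\<close>. If \<open>u\<close> has colour \<open>q\<close>, none of them has it;
        otherwise all occurrences of \<open>q\<close> are already counted around
        \<open>u\<close>.\<close>
      show ?thesis
      proof (cases "c u = q")
        case True
        then have "{y \<in> ?N v. c y = q} \<subseteq> {u}" using u proper by blast
        then have "card {y \<in> ?N v. c y = q} \<le> card {u}" by (intro card_mono) auto
        then show ?thesis using k eq by simp
      next
        case False
        then have "{y \<in> ?N v. c y = q} \<subseteq> {y \<in> neighbourhood E' u. c y = q}"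
          using u by (auto simp: neighbourhood_def)
        then have "card {y \<in> ?N v. c y = q} \<le> card {y \<in> neighbourhood E' u. c y = q}"
          using finE' by (intro card_mono) auto
        then show ?thesis using frugal[of u q] u(1) NV[of v] eq by force
      qed
    qed (unfold eq, simp)
  next
    case False
    have "{y \<in> ?N z - {v}. c y = q} \<subseteq> {y \<in> neighbourhood E' z. c y = q}"
      using old False by (auto simp: neighbourhood_def)
    then have "card {y \<in> ?N z - {v}. c y = q} \<le> card {y \<in> neighbourhood E' z. c y = q}"
      using finE' by (intro card_mono) auto
    then have le: "card {y \<in> ?N z - {v}. c y = q} \<le> k" using frugal[of z q] z False by force
    \<comment> \<open>Only the colour \<open>x\<close> around a neighbour of \<open>v\<close> gains
      a vertex, and \<open>x\<close> lies outside \<open>F z\<close>, which leaves room for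
      it.\<close>
    show ?thesis
    proof (cases "v \<in> ?N z \<and> q = x")
      case True
      then have "{y \<in> ?N z. (c(v := x)) y = q} = insert v {y \<in> ?N z - {v}. c y = q}" by auto
      then have "card {y \<in> ?N z. (c(v := x)) y = q} \<le> Suc (card {y \<in> ?N z - {v}. c y = x})"
        using True by (simp add: card_insert_le_m1 fin)
      moreover have "card {y \<in> ?N z - {v}. c y = x} < k"
        using x(3)[of z] True neighbourhood_sym[of v E z] by (simp add: F_def)
      ultimately show ?thesis by simp
    next
      case False
      then have "{y \<in> ?N z. (c(v := x)) y = q} = {y \<in> ?N z - {v}. c y = q}" by auto
      then show ?thesis using le by simp
    qed
  qed
  ultimately have "frugal_colouring k V E (c(v := x))" unfolding frugal_colouring_def by blast
  then show ?thesis using x(1) by blast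
qed

text \<open>Induction on the number of vertices. \<open>C\<close> is a fixed upper bound for the
  degrees rather than the maximum degree, so the list size survives a contraction that changes the
  maximum degree.\<close>

lemma frugal_colouring_exists:
  assumes "cluster_drawing V E X A"
    and k: "1 \<le> k" and C: "12 \<le> C" and deg: "\<And>u. u \<in> V \<Longrightarrow> vertex_degree E u \<le> C"
    and L: "\<And>v. v \<in> V \<Longrightarrow> card (L v :: 'c set) = (2 * C + 19) div k + 6"
  shows "\<exists>c. frugal_colouring k V E c \<and> (\<forall>v\<in>V. c v \<in> L v)"
  using assms(1) deg L
proof (induction "card V" arbitrary: V E X A L)
  case 0
  interpret cluster_drawing V E X A by fact
  have "V = {}" using 0(1) finite_V by simp
  then have "E = {}" using edge_subset card_edge by fastforce
  then show ?case using \<open>V = {}\<close> by (simp add: frugal_colouring_def proper_colouring_def)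
next
  case (Suc n)
  interpret cluster_drawing V E X A by fact
  let ?N = "neighbourhood E" and ?d = "vertex_degree E"
  note G = simple_graph
  have deg: "?d u \<le> C" if "u \<in> V" for u using Suc.prems(2)[OF that] .
  have "V \<noteq> {}" using Suc.hyps(2) by auto
  then obtain v where v: "v \<in> V" "?d v \<le> 5" "(\<Sum>u\<in>?N v. ?d u - 1) \<le> 2 * C + 19"
    "?N v = {} \<or> (\<exists>u\<in>?N v. ?d u + ?d v \<le> C + 2)"
    using reducible_vertex[OF _ C deg] by blast
  have NV: "?N z \<subseteq> V - {z}" for z by (rule neighbourhood_subset[OF G])
  have fin: "finite (?N z)" for z by (rule finite_neighbourhood[OF G])
  obtain X' A' E' where draw: "cluster_drawing (V - {v}) E' X' A'"
    and sub: "E \<inter> Pow (V - {v}) \<subseteq> E'"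
    and star: "?N v = {} \<or> (\<exists>u\<in>?N v. \<forall>w\<in>?N v. w \<noteq> u \<longrightarrow> {u, w} \<in> E')"
    and deg': "\<And>z. z \<in> V - {v} \<Longrightarrow> vertex_degree E' z \<le> C"
  proof (cases "?N v = {}")
    case True
    have "E \<inter> Pow (V - {v}) \<subseteq> E" by blast
    then have "cluster_drawing (V - {v}) (E \<inter> Pow (V - {v})) X A"
      by (intro subgraph) auto
    moreover have "vertex_degree (E \<inter> Pow (V - {v})) z \<le> C" if "z \<in> V - {v}" for z
    proof -
      have "vertex_degree (E \<inter> Pow (V - {v})) z \<le> ?d z"
        unfolding vertex_degree_def using fin by (intro card_mono) (auto simp: neighbourhood_def)
      then show ?thesis using deg[of z] that by simp
    qed
    ultimately show thesis using that[of "E \<inter> Pow (V - {v})" X A] True by blast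
  next
    case False
    then obtain u where u: "u \<in> ?N v" "?d u + ?d v \<le> C + 2" using v(4) by blast
    let ?E' = "E \<inter> Pow (V - {v}) \<union> {{u, w} |w. {v, w} \<in> E \<and> w \<noteq> u}"
    have uv: "{v, u} \<in> E" "u \<noteq> v" using u(1) NV[of v] by (auto simp: neighbourhood_def)
    have vu: "v \<in> ?N u" using u(1) neighbourhood_sym[of u E v] by simp
    obtain X' A' where draw: "cluster_drawing (V - {v}) ?E' X' A'" using contract[OF uv] by blast
    have "vertex_degree ?E' z \<le> C" if z: "z \<in> V - {v}" for z
    proof (cases "z = u")
      case True
      \<comment> \<open>The vertex \<open>u\<close> loses \<open>v\<close> and gains at most the
        other neighbours of \<open>v\<close>, hence the bound \<open>C + 2\<close> on the two
        degrees.\<close>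
      have "neighbourhood ?E' z \<subseteq> (?N u - {v}) \<union> (?N v - {u})"
        using True by (auto simp: neighbourhood_def doubleton_eq_iff)
      then have "vertex_degree ?E' z \<le> card ((?N u - {v}) \<union> (?N v - {u}))"
        unfolding vertex_degree_def using fin by (intro card_mono) auto
      also have "\<dots> \<le> card (?N u - {v}) + card (?N v - {u})" by (rule card_Un_le)
      also have "\<dots> = (?d u - 1) + (?d v - 1)"
        using u(1) vu by (simp add: vertex_degree_def)
      also have "\<dots> \<le> C"
        using u(2) fin card_gt_0_iff[of "?N u"] card_gt_0_iff[of "?N v"] u(1) vu
        unfolding vertex_degree_def by auto
      finally show ?thesis .
    next
      case zu: False
      show ?thesis
      proof (cases "z \<in> ?N v")
        case True
        then have vz: "v \<in> ?N z" using neighbourhood_sym[of v E z] by simp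
        \<comment> \<open>Another neighbour of \<open>v\<close> trades \<open>v\<close> for
          \<open>u\<close>, so its degree does not grow.\<close>
        have "neighbourhood ?E' z \<subseteq> insert u (?N z - {v})"
          using zu z by (auto simp: neighbourhood_def doubleton_eq_iff)
        then have "vertex_degree ?E' z \<le> card (insert u (?N z - {v}))"
          unfolding vertex_degree_def using fin by (intro card_mono) auto
        also have "\<dots> \<le> Suc (card (?N z - {v}))" by (rule card_insert_le_m1) auto
        also have "\<dots> = ?d z"
          using vz card_Suc_Diff1[OF fin vz] by (simp add: vertex_degree_def)
        finally show ?thesis using deg[of z] z by simp
      next
        case False
        then have "neighbourhood ?E' z \<subseteq> ?N z"
          using zu by (auto simp: neighbourhood_def doubleton_eq_iff)
        then have "vertex_degree ?E' z \<le> ?d z"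
          unfolding vertex_degree_def using fin by (intro card_mono) auto
        then show ?thesis using deg[of z] z by simp
      qed
    qed
    moreover have "\<forall>w\<in>?N v. w \<noteq> u \<longrightarrow> {u, w} \<in> ?E'" by (auto simp: neighbourhood_def)
    ultimately show thesis using that[of ?E' X' A'] draw u(1) by blast
  qed
  interpret small: cluster_drawing "V - {v}" E' X' A' by (rule draw)
  have "n = card (V - {v})" using Suc.hyps(2) v(1) finite_V by simp
  then obtain c where c: "frugal_colouring k (V - {v}) E' c" "\<forall>w\<in>V - {v}. c w \<in> L w"
    using Suc.hyps(1)[OF _ draw deg', of L] Suc.prems(3) by auto
  \<comment> \<open>The 6 in the list size consists of at most five colours of the neighbours of
    \<open>v\<close> and one colour to spare.\<close>
  have "(\<Sum>u\<in>?N v. ?d u - 1) div k \<le> (2 * C + 19) div k" using v(3) by (rule div_le_mono)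
  then have "?d v + (\<Sum>u\<in>?N v. ?d u - 1) div k < card (L v)"
    using v(2) Suc.prems(3)[OF v(1)] by simp
  then obtain x where "x \<in> L v" "frugal_colouring k V E (c(v := x))"
    using extend_colouring[OF G k v(1) small.simple_graph sub star c(1)] by blast
  then show ?case using c(2) by (intro exI[of _ "c(v := x)"]) auto
qed

theorem theorem4:
  fixes V :: "'a set" and E :: "'a set set" and k :: nat
  assumes "simple_graph V E"
    and "planar V E"
    and "max_degree V E \<ge> 12"
    and "k \<ge> 1"
  shows "int (frugal_choice_number k V E)
           \<le> \<lfloor>(2 * real (max_degree V E) + 19) / real k\<rfloor> + 6"
proof -
  let ?C = "max_degree V E"
  obtain p \<gamma> where "plane_drawing V E p \<gamma>" using assms(2) by (auto simp: planar_def)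
  then interpret cluster_drawing V E "\<lambda>x. {p x}" \<gamma>
    by (rule planar_cluster_drawing[OF assms(1)])
  have "vertex_degree E u \<le> ?C" if "u \<in> V" for u
    unfolding max_degree_def using finite_V that by (intro Max_ge) auto
  then have "frugal_choosable k ((2 * ?C + 19) div k + 6) V E"
    unfolding frugal_choosable_def list_assignment_def
    using frugal_colouring_exists[OF cluster_drawing_axioms assms(4,3)] by blast
  then have "frugal_choice_number k V E \<le> (2 * ?C + 19) div k + 6"
    unfolding frugal_choice_number_def by (rule Least_le)
  moreover have "\<lfloor>(2 * real ?C + 19) / real k\<rfloor> = int ((2 * ?C + 19) div k)"
    using floor_divide_of_nat_eq[of "2 * ?C + 19" k] by simp
  ultimately show ?thesis by linarith
qed

end
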